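(* Let $X$ be a stacked simplicial complex of dimension $d$ which is not a cone, and let $T$ be the associated hypertree. Then: (a) $T$ has $\geq d+2$ vertices. (b) If $T$ has an edge of cardinality $\geq 3$, then $T$ has $\geq d+3$ vertices. (c) If $T$ has $\geq d+3$ vertices, then $X$ may be separated to a (stacked) simplicial complex $X'$ whose hypertree $T'$ is a refinement of $T$. (d) If $T$ is an ordinary tree with $d+2$ vertices, then $X$ is inseparable and the isomorphism class of $X$ is uniquely determined by $T$.
   Context: A simplicial complex is finite, and it is a cone if some vertex lies in all its facets. A pure simplicial complex $X$ (all facets of the same cardinality) is stacked if its facets can be ordered $F_0,\ldots,F_k$ such that for each $p\ge1$, with $X_{p-1}$ the complex generated by $F_0,\ldots,F_{p-1}$, one has $F_p=G_p\cup\{v_p\}$ where $G_p$ is a face of $X_{p-1}$ and $v_p$ is not a vertex of $X_{p-1}$. A hypergraph $(V,E)$ consists of a set $V$ and a collection $E$ of subsets (edges) of $V$, none contained in another. It is a hypertree if (i) any two distinct edges meet in at most one vertex; (ii) it is connected (any two vertices are joined by a sequence of edges, consecutive ones meeting); (iii) it has no cycle, i.e. no sequence of distinct vertices $v_0,v_1,\ldots,v_n$, except that $v_n=v_0$, $n\ge3$, such that each pair $\{v_{i-1},v_i\}$ is contained in an edge but no triple $\{v_{i-1},v_i,v_{i+1}\}$ is contained in an edge. If $T',T$ are hypertrees on the same vertex set, $T'$ is a refinement of $T$ if every edge of $T'$ is contained in an edge of $T$ and every edge of $T$ is a union of edges of $T'$. Let $X$ be stacked with facets $F_v$ indexed by $v\in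 V$. The associated hypertree $T$ has vertex set $V$, and its edges are the sets $e_G=\{v\in V\mid F_v\supseteq G\}$ with $|e_G|\ge2$, for $G$ a codimension-one face of $X$. $T$ is an ordinary tree if all its edges have cardinality $2$. Separation: let $p:A'\to A$ be a surjection of finite sets with $|A'|=|A|+1$, and $a_1\ne a_2$ in $A'$ the two elements mapping to the same $a\in A$. For monomial ideals $I\subseteq k[x_A]$, $J\subseteq k[x_{A'}]$ ($k$ a field, polynomial rings with variables indexed by $A$, $A'$), $J$ is a simple separation of $I$ if (i) $I$ is the image of $J$ under the induced map $k[x_{A'}]\to k[x_A]$; (ii) both $x_{a_1}$ and $x_{a_2}$ occur in some minimal generators of $J$; (iii) $x_{a_1}-x_{a_2}$ is a non-zero divisor on $k[x_{A'}]/J$. A separation is obtained by a succession of (one or more) simple separations. "$X$ may be separated to $X'$" means that the Stanley--Reisner ideal $I_{X'}$ is a separation of $I_X$; "$X$ is inseparable" means that $I_X$ has no simple separation. In a simple separation $I_{X'}$ of $I_X$, the facets of $X'$ correspond bijectively to those of $X$ (a facet $F'$ of $X'$ corresponds to $(F'\setminus\{a_1,a_2\})\cup\{a\}$ if it contains both $a_1,a_2$, and to $F'\setminus\{a_1,a_2\}$ if it contains exactly one of them), and through these bijections the hypertrees of $X$ and $X'$ are considered on the same vertex set. *)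

theory Defs
  imports "HOL-Algebra.QuotRing" "HOL-Library.Poly_Mapping" "HOL-Library.Infinite_Typeclass"
begin

section \<open>Simplicial complexes\<close>

text \<open>A complex is identified with its set of faces; its vertices are the elements of \<open>\<Union>X\<close>.\<close>

definition simplicial_complex :: "'v set set \<Rightarrow> bool" where
  "simplicial_complex X \<longleftrightarrow>
     finite X \<and> (\<forall>F\<in>X. finite F) \<and> (\<forall>F\<in>X. \<forall>G. G \<subseteq> F \<longrightarrow> G \<in> X)"

definition vertices :: "'v set set \<Rightarrow> 'v set" where
  "vertices X = \<Union>X"

definition facets :: "'v set set \<Rightarrow> 'v set set" where
  "facets X = {F \<in> X. \<forall>G\<in>X. F \<subseteq> G \<longrightarrow> G = F}"

text \<open>Integer-valued, since the complex whose only face is the empty set has dimension \<open>-1\<close>.\<close>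

definition complex_dim :: "'v set set \<Rightarrow> int" where
  "complex_dim X = (MAX F\<in>X. int (card F) - 1)"

definition is_cone :: "'v set set \<Rightarrow> bool" where
  "is_cone X \<longleftrightarrow> (\<exists>v\<in>vertices X. \<forall>F\<in>facets X. v \<in> F)"

definition pure :: "'v set set \<Rightarrow> bool" where
  "pure X \<longleftrightarrow> (\<forall>F\<in>facets X. \<forall>G\<in>facets X. card F = card G)"

definition generated_complex :: "'v set set \<Rightarrow> 'v set set" where
  "generated_complex Fs = {G. \<exists>F\<in>Fs. G \<subseteq> F}"

definition stacked :: "'v set set \<Rightarrow> bool" where
  "stacked X \<longleftrightarrow> simplicial_complex X \<and> pure X \<and>
     (\<exists>Fs. Fs \<noteq> [] \<and> distinct Fs \<and> set Fs = facets X \<and>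
        (\<forall>p. 1 \<le> p \<and> p < length Fs \<longrightarrow>
           (let Y = generated_complex (set (take p Fs))
            in \<exists>G v. Fs ! p = G \<union> {v} \<and> G \<in> Y \<and> v \<notin> vertices Y)))"

definition complex_iso :: "'v set set \<Rightarrow> 'w set set \<Rightarrow> bool" where
  "complex_iso X Y \<longleftrightarrow> (\<exists>f. bij_betw f (vertices X) (vertices Y) \<and> Y = (\<lambda>F. f ` F) ` X)"


section \<open>Hypertrees\<close>

type_synonym 'i hypergraph = "'i set \<times> 'i set set"

abbreviation hverts :: "'i hypergraph \<Rightarrow> 'i set" where "hverts \<equiv> fst"
abbreviation hedges :: "'i hypergraph \<Rightarrow> 'i set set" where "hedges \<equiv> snd"

definition hypergraph :: "'i hypergraph \<Rightarrow> bool" where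
  "hypergraph T \<longleftrightarrow> (\<forall>e\<in>hedges T. e \<subseteq> hverts T) \<and>
     (\<forall>e\<in>hedges T. \<forall>f\<in>hedges T. e \<subseteq> f \<longrightarrow> e = f)"

definition hconnected :: "'i hypergraph \<Rightarrow> bool" where
  "hconnected T \<longleftrightarrow> (\<forall>v\<in>hverts T. \<forall>w\<in>hverts T. v \<noteq> w \<longrightarrow>
     (\<exists>es. es \<noteq> [] \<and> set es \<subseteq> hedges T \<and> v \<in> hd es \<and> w \<in> last es \<and>
           successively (\<lambda>e f. e \<inter> f \<noteq> {}) es))"

text \<open>The condition on triples ranges over the indices for which the triple lies in the sequence
  \<open>v 0, \<dots>, v n\<close>.  If distinct edges meet in at most one vertex, then a cycle in
  this sense exists iff one exists that also satisfies the condition for the closing triple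
  \<open>v (n - 1), v 0, v 1\<close>.\<close>

definition is_hcycle :: "'i hypergraph \<Rightarrow> nat \<Rightarrow> (nat \<Rightarrow> 'i) \<Rightarrow> bool" where
  "is_hcycle T n v \<longleftrightarrow> n \<ge> 3 \<and> (\<forall>i\<le>n. v i \<in> hverts T) \<and> inj_on v {..<n} \<and> v n = v 0 \<and>
     (\<forall>i. 1 \<le> i \<and> i \<le> n \<longrightarrow> (\<exists>e\<in>hedges T. {v (i - 1), v i} \<subseteq> e)) \<and>
     (\<forall>i. 1 \<le> i \<and> i < n \<longrightarrow> \<not> (\<exists>e\<in>hedges T. {v (i - 1), v i, v (i + 1)} \<subseteq> e))"

definition hypertree :: "'i hypergraph \<Rightarrow> bool" where
  "hypertree T \<longleftrightarrow> hypergraph T \<and>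
     (\<forall>e\<in>hedges T. \<forall>f\<in>hedges T. e \<noteq> f \<longrightarrow> (\<forall>x\<in>e \<inter> f. \<forall>y\<in>e \<inter> f. x = y)) \<and>
     hconnected T \<and> \<not> (\<exists>n v. is_hcycle T n v)"

definition refinement :: "'i hypergraph \<Rightarrow> 'i hypergraph \<Rightarrow> bool" where
  "refinement T' T \<longleftrightarrow> hypertree T' \<and> hypertree T \<and> hverts T' = hverts T \<and>
     (\<forall>e'\<in>hedges T'. \<exists>e\<in>hedges T. e' \<subseteq> e) \<and>
     (\<forall>e\<in>hedges T. \<exists>S. S \<subseteq> hedges T' \<and> e = \<Union>S)"

definition ordinary_tree :: "'i hypergraph \<Rightarrow> bool" where
  "ordinary_tree T \<longleftrightarrow> (\<forall>e\<in>hedges T. card e = 2)"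

definition facet_indexing :: "'v set set \<Rightarrow> 'i set \<Rightarrow> ('i \<Rightarrow> 'v set) \<Rightarrow> bool" where
  "facet_indexing X V F \<longleftrightarrow> bij_betw F V (facets X)"

definition assoc_hypertree :: "'v set set \<Rightarrow> 'i set \<Rightarrow> ('i \<Rightarrow> 'v set) \<Rightarrow> 'i hypergraph" where
  "assoc_hypertree X V F =
     (V, {e. \<exists>G\<in>X. int (card G) - 1 = complex_dim X - 1 \<and> e = {v \<in> V. G \<subseteq> F v} \<and> card e \<ge> 2})"


section \<open>Polynomial rings and monomial ideals\<close>

text \<open>A polynomial maps exponent vectors to coefficients; multiplication on
  \<^typ>\<open>('v \<Rightarrow>\<^sub>0 nat) \<Rightarrow>\<^sub>0 'k::field\<close> is convolution, i.e. multiplication of polynomials in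
  commuting variables indexed by the type \<^typ>\<open>'v\<close>.  The ring \<open>poly_ring A\<close> consists of the
  polynomials in which only variables with index in \<open>A\<close> occur.\<close>

type_synonym 'v expo = "'v \<Rightarrow>\<^sub>0 nat"
type_synonym ('v, 'k) mpoly = "('v \<Rightarrow>\<^sub>0 nat) \<Rightarrow>\<^sub>0 'k"

definition poly_ring :: "'v set \<Rightarrow> ('v, 'k::field) mpoly ring" where
  "poly_ring A = \<lparr>carrier = {f. \<forall>m\<in>Poly_Mapping.keys f. Poly_Mapping.keys m \<subseteq> A},
     mult = (*), one = 1, zero = 0, add = (+)\<rparr>"

definition monom :: "'v expo \<Rightarrow> ('v, 'k::field) mpoly" where
  "monom m = Poly_Mapping.single m 1"

definition pvar :: "'v \<Rightarrow> ('v, 'k::field) mpoly" where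
  "pvar a = monom (Poly_Mapping.single a 1)"

definition monomial_ideal :: "'v set \<Rightarrow> ('v, 'k::field) mpoly set \<Rightarrow> bool" where
  "monomial_ideal A I \<longleftrightarrow>
     (\<exists>M. (\<forall>m\<in>M. Poly_Mapping.keys m \<subseteq> A) \<and> I = genideal (poly_ring A) (monom ` M))"

text \<open>(Exponents of) the minimal monomial generators of a monomial ideal: the monomials of the
  ideal that are minimal under divisibility.\<close>

definition min_generators :: "('v, 'k::field) mpoly set \<Rightarrow> 'v expo set" where
  "min_generators I = {m. monom m \<in> I \<and>
     (\<forall>m'. monom m' \<in> I \<and> (\<forall>a. Poly_Mapping.lookup m' a \<le> Poly_Mapping.lookup m a) \<longrightarrow> m' = m)}"

text \<open>The homomorphism of \<open>k\<close>-algebras sending the variable \<open>x\<^sub>a\<close> to \<open>x\<^bsub>p a\<^esub>\<close>.\<close>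

definition induced_map :: "('v \<Rightarrow> 'w) \<Rightarrow> ('v, 'k::field) mpoly \<Rightarrow> ('w, 'k) mpoly" where
  "induced_map p f =
     (\<Sum>m\<in>Poly_Mapping.keys f. Poly_Mapping.single 0 (Poly_Mapping.lookup f m) *
        (\<Prod>a\<in>Poly_Mapping.keys m. pvar (p a) ^ Poly_Mapping.lookup m a))"

definition nonzero_divisor :: "('r, 'm) ring_scheme \<Rightarrow> 'r \<Rightarrow> bool" where
  "nonzero_divisor R r \<longleftrightarrow>
     r \<in> carrier R \<and> (\<forall>s\<in>carrier R. r \<otimes>\<^bsub>R\<^esub> s = \<zero>\<^bsub>R\<^esub> \<longrightarrow> s = \<zero>\<^bsub>R\<^esub>)"

text \<open>The Stanley-Reisner ideal lives in the polynomial ring on the vertices of the complex and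
  is generated by the squarefree monomials of its non-faces.\<close>

definition squarefree_expo :: "'v set \<Rightarrow> 'v expo" where
  "squarefree_expo S = (\<Sum>a\<in>S. Poly_Mapping.single a 1)"

definition stanley_reisner :: "'v set set \<Rightarrow> ('v, 'k::field) mpoly set" where
  "stanley_reisner X = genideal (poly_ring (vertices X))
     {monom (squarefree_expo S) | S. S \<subseteq> vertices X \<and> S \<notin> X}"


section \<open>Separations\<close>

text \<open>\<open>simple_separation A I p a1 a2 A' J\<close>: the ideal \<open>J\<close> of \<open>k[x_A']\<close> is a
  simple separation of the ideal \<open>I\<close> of \<open>k[x_A]\<close> along \<open>p\<close>, with \<open>a1\<close>, \<open>a2\<close> the two elements
  identified by \<open>p\<close>.\<close>

definition simple_separation ::
  "'v set \<Rightarrow> ('v, 'k::field) mpoly set \<Rightarrow> ('w \<Rightarrow> 'v) \<Rightarrow> 'w \<Rightarrow> 'w \<Rightarrow>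
   'w set \<Rightarrow> ('w, 'k) mpoly set \<Rightarrow> bool" where
  "simple_separation A I p a1 a2 A' J \<longleftrightarrow>
     finite A \<and> finite A' \<and> p ` A' = A \<and> card A' = card A + 1 \<and>
     a1 \<in> A' \<and> a2 \<in> A' \<and> a1 \<noteq> a2 \<and> p a1 = p a2 \<and>
     monomial_ideal A I \<and> monomial_ideal A' J \<and>
     I = induced_map p ` J \<and>
     (\<exists>m\<in>min_generators J. a1 \<in> Poly_Mapping.keys m) \<and>
     (\<exists>m\<in>min_generators J. a2 \<in> Poly_Mapping.keys m) \<and>
     nonzero_divisor (poly_ring A' Quot J) (J +>\<^bsub>poly_ring A'\<^esub> (pvar a1 - pvar a2))"

text \<open>The facet of \<open>X\<close> corresponding to a facet of \<open>X'\<close>, for a simple separation of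
  Stanley-Reisner ideals; elements other than \<open>a1\<close>, \<open>a2\<close> are identified with their
  images under \<open>p\<close>.\<close>

definition facet_map :: "('w \<Rightarrow> 'v) \<Rightarrow> 'w \<Rightarrow> 'w \<Rightarrow> 'w set \<Rightarrow> 'v set" where
  "facet_map p a1 a2 F' =
     (if a1 \<in> F' \<and> a2 \<in> F' then insert (p a1) (p ` (F' - {a1, a2})) else p ` (F' - {a1, a2}))"

text \<open>A succession of one or more simple separations leading from \<open>I\<close> to \<open>J\<close>, where \<open>\<phi>\<close> is the
  composite of the facet correspondences of the single steps.\<close>

inductive separation ::
  "'v set \<Rightarrow> ('v, 'k::field) mpoly set \<Rightarrow> ('v set \<Rightarrow> 'v set) \<Rightarrow>
   'v set \<Rightarrow> ('v, 'k) mpoly set \<Rightarrow> bool"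
  for A :: "'v set" and I :: "('v, 'k::field) mpoly set" where
  single: "simple_separation A I p a1 a2 A' J \<Longrightarrow> separation A I (facet_map p a1 a2) A' J"
| step: "separation A I \<phi> A' J \<Longrightarrow> simple_separation A' J p a1 a2 A'' K \<Longrightarrow>
    separation A I (\<phi> \<circ> facet_map p a1 a2) A'' K"

definition separates_to ::
  "'k::field itself \<Rightarrow> 'v set set \<Rightarrow> ('v set \<Rightarrow> 'v set) \<Rightarrow> 'v set set \<Rightarrow> bool" where
  "separates_to _ X \<phi> X' \<longleftrightarrow>
     separation (vertices X) (stanley_reisner X :: ('v, 'k) mpoly set) \<phi>
                (vertices X') (stanley_reisner X')"

text \<open>The type of vertices is required to be infinite so that the new variables of a separation
  are always available in it; over a finite type inseparability would be too weak.\<close>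

definition inseparable :: "'k::field itself \<Rightarrow> 'v::infinite set set \<Rightarrow> bool" where
  "inseparable _ X \<longleftrightarrow>
     \<not> (\<exists>(p :: 'v \<Rightarrow> 'v) a1 a2 A' J.
          simple_separation (vertices X) (stanley_reisner X :: ('v, 'k) mpoly set) p a1 a2 A' J)"

end

theory Submission
  imports Defs
begin

text \<open>Order the facets as in a stacking, with \<open>n = d + 1\<close> vertices each. A facet \<open>F v\<close> other than the first
  arises from an earlier facet, its parent, by dropping a vertex \<open>y v\<close> and adding a new vertex \<open>x v\<close>.
  This makes the index set a rooted tree, and the hypertree is a hypertree because the latest facet on
  a cycle meets both its neighbours in the ridge along which it was attached.

  If the complex is not a cone, each of the \<open>n\<close> vertices of the first facet is dropped at some step, so
  there are at least \<open>n\<close> steps (\<open>card_V_ge\<close>). The last facet of an edge with three or more members loses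
  nothing new, which costs one further step (\<open>card_V_ge_of_large_edge\<close>).

  If there are at least \<open>n + 1\<close> steps, then either some \<open>y r\<close> is not in the first facet, or \<open>y r = y t\<close> for
  different \<open>r\<close> and \<open>t\<close>. In both cases the facets that avoid the vertex \<open>y r\<close> fall apart into a branch of
  the tree and a nonempty rest (\<open>exists_splitting\<close>). The vertex is split in two: the facets of the branch
  receive one copy, the remaining facets that avoid it receive the other, and the facets containing it
  receive both. The result is again stacked, its hypertree refines the old one, and as a face of facets
  on both sides lies in a facet containing the split vertex (\<open>face_of_both_sides\<close>), the result is a
  simple separation (\<open>simple_separation_split\<close>).

  If there are exactly \<open>n\<close> steps, then \<open>y\<close> is a bijection onto the first facet. The set of facets
  through \<open>x v\<close> is the branch below \<open>v\<close>, and that through \<open>y v\<close> is the complement of this branch. When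
  the hypertree is an ordinary tree, these are the sets cut off by single edges (\<open>holders_image\<close>), so
  that the tree determines the complex. Moreover, the facets avoiding a vertex are connected in the
  tree. In a simple separation each such facet lies on one of two sides, according to which of the two
  separated variables multiplies its monomial into the ideal; neighbours lie on the same side because
  their ridge lies in no third facet, yet both sides are inhabited (\<open>not_simple_separation\<close>).

  On the algebraic side, all ideals involved are spanned by monomials, so that their images and membership in
  them can be read off from exponents. The difference of two variables is a non-zero divisor modulo a
  Stanley-Reisner ideal if every face stays a face on adding one of them (\<open>nonzero_divisor_stanley_reisner\<close>).
  Conversely, a non-zero divisor forces every monomial that both variables multiply into the ideal to
  lie in it (\<open>nonzero_divisor_monomials\<close>). Together with the conditions on images and generators, this
  is all that is used of an arbitrary simple separation (\<open>monomial_separation\<close>).\<close>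

section \<open>Monomial ideals as sets of monomials\<close>

text \<open>The polynomials all of whose monomials lie in \<open>M\<close>. Carriers of polynomial rings and monomial
  ideals are of this form, so that statements about them become statements about exponents.\<close>

definition supported :: "'v expo set \<Rightarrow> ('v, 'k::field) mpoly set" where
  "supported M = {f. Poly_Mapping.keys f \<subseteq> M}"

text \<open>Exponents of monomials in the variables of \<open>A\<close>, and the sets of such monomials that are closed
  under multiplication by all of them.\<close>

definition expos :: "'v set \<Rightarrow> 'v expo set" where
  "expos A = {m. Poly_Mapping.keys m \<subseteq> A}"

definition upclosed :: "'v set \<Rightarrow> 'v expo set \<Rightarrow> bool" where
  "upclosed A M \<longleftrightarrow> M \<subseteq> expos A \<and> (\<forall>m\<in>M. \<forall>m'\<in>expos A. m + m' \<in> M)"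

lemma keys_add_expo: "Poly_Mapping.keys (m + m' :: 'v expo) = Poly_Mapping.keys m \<union> Poly_Mapping.keys m'"
  by (auto simp: in_keys_iff lookup_add)

lemma expo_le_imp_add:
  assumes "\<forall>a. Poly_Mapping.lookup m a \<le> Poly_Mapping.lookup (m' :: 'v expo) a"
  shows "m' = m + (m' - m)"
  by (rule poly_mapping_eqI) (simp add: lookup_add lookup_minus assms)

lemma upclosed_le:
  assumes "upclosed A M" "m \<in> M" "m' \<in> expos A"
    and "\<forall>a. Poly_Mapping.lookup m a \<le> Poly_Mapping.lookup m' a"
  shows "m' \<in> M"
proof -
  have "Poly_Mapping.keys (m' - m) \<subseteq> Poly_Mapping.keys m'"
    by (auto simp: in_keys_iff lookup_minus)
  then have "m' - m \<in> expos A" using assms(3) by (auto simp: expos_def)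
  then show ?thesis
    using assms(1,2) expo_le_imp_add[OF assms(4)] unfolding upclosed_def by metis
qed

lemma supported_0: "0 \<in> supported M"
  by (simp add: supported_def)

lemma supported_add: "f \<in> supported M \<Longrightarrow> g \<in> supported M \<Longrightarrow> f + g \<in> supported M"
  using keys_add[of f g] by (auto simp: supported_def)

lemma supported_uminus: "f \<in> supported M \<Longrightarrow> - f \<in> supported M"
  by (auto simp: supported_def in_keys_iff)

lemma supported_diff: "f \<in> supported M \<Longrightarrow> g \<in> supported M \<Longrightarrow> f - g \<in> supported M"
  using supported_add[of f M "- g"] supported_uminus[of g M] by simp

lemma supported_sum: "(\<And>i. i \<in> I \<Longrightarrow> f i \<in> supported M) \<Longrightarrow> sum f I \<in> supported M"
  by (induction I rule: infinite_finite_induct) (auto simp: supported_0 supported_add)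

lemma supported_mult:
  assumes "f \<in> supported M" "g \<in> supported N" "\<And>m n. m \<in> M \<Longrightarrow> n \<in> N \<Longrightarrow> m + n \<in> L"
  shows "f * g \<in> supported L"
  using assms keys_mult[of f g] by (auto simp: supported_def) blast

lemma single_in_supported: "c = 0 \<or> m \<in> M \<Longrightarrow> Poly_Mapping.single m c \<in> supported M"
  by (auto simp: supported_def)

lemma monom_in_supported [simp]: "(monom m :: ('v, 'k::field) mpoly) \<in> supported M \<longleftrightarrow> m \<in> M"
  by (auto simp: supported_def monom_def)

lemma supported_subset_iff [simp]:
  "(supported M :: ('v, 'k::field) mpoly set) \<subseteq> supported N \<longleftrightarrow> M \<subseteq> N"
proof
  assume l: "(supported M :: ('v, 'k) mpoly set) \<subseteq> supported N"
  show "M \<subseteq> N"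
  proof
    fix m assume "m \<in> M"
    then have "(monom m :: ('v, 'k) mpoly) \<in> supported M" by simp
    with l have "(monom m :: ('v, 'k) mpoly) \<in> supported N" by blast
    then show "m \<in> N" by simp
  qed
qed (auto simp: supported_def)

lemma supported_eq_iff: "(supported M :: ('v, 'k::field) mpoly set) = supported N \<longleftrightarrow> M = N"
  unfolding set_eq_subset by simp

lemma poly_mapping_sum_single:
  "(\<Sum>m\<in>Poly_Mapping.keys f. Poly_Mapping.single m (Poly_Mapping.lookup f m)) = f"
  by (rule poly_mapping_eqI) (simp add: lookup_sum lookup_single when_def in_keys_iff sum.delta)

lemma carrier_poly_ring: "carrier (poly_ring A) = supported (expos A)"
  by (auto simp: poly_ring_def supported_def expos_def)

lemma poly_ring_simps [simp]:
  "mult (poly_ring A) = (*)" "one (poly_ring A) = 1" "zero (poly_ring A) = 0" "add (poly_ring A) = (+)"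
  by (auto simp: poly_ring_def)

lemma expos_add: "m \<in> expos A \<Longrightarrow> n \<in> expos A \<Longrightarrow> m + n \<in> expos A"
  by (simp add: expos_def keys_add_expo)

lemma cring_poly_ring: "cring (poly_ring A :: ('v, 'k::field) mpoly ring)"
proof (rule cringI)
  show "abelian_group (poly_ring A :: ('v, 'k) mpoly ring)"
  proof (rule abelian_groupI; simp add: carrier_poly_ring supported_add supported_0 add.assoc add.commute)
    fix f :: "('v, 'k) mpoly" assume "f \<in> supported (expos A)"
    then show "\<exists>g\<in>supported (expos A). f + g = 0"
      by (intro bexI[of _ "- f"]) (auto simp: supported_uminus)
  qed
  show "comm_monoid (poly_ring A :: ('v, 'k) mpoly ring)"
  proof (rule comm_monoidI; simp add: carrier_poly_ring mult.assoc mult.commute)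
    show "f * g \<in> supported (expos A)"
      if "f \<in> supported (expos A)" "g \<in> supported (expos A)" for f g :: "('v, 'k) mpoly"
      using that by (rule supported_mult) (rule expos_add)
    show "(1 :: ('v, 'k) mpoly) \<in> supported (expos A)"
      by (simp add: supported_def expos_def)
  qed
qed (simp add: carrier_poly_ring algebra_simps)

lemma minus_poly_ring:
  assumes "f \<in> carrier (poly_ring A :: ('v, 'k::field) mpoly ring)"
  shows "\<ominus>\<^bsub>poly_ring A\<^esub> f = - f"
proof -
  interpret cring "poly_ring A :: ('v, 'k) mpoly ring" by (rule cring_poly_ring)
  show ?thesis
    using assms by (intro minus_equality) (auto simp: carrier_poly_ring supported_uminus)
qed

lemma ideal_supported:
  assumes "upclosed A M"
  shows "ideal (supported M) (poly_ring A :: ('v, 'k::field) mpoly ring)"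
proof (rule idealI)
  let ?R = "poly_ring A :: ('v, 'k) mpoly ring"
  interpret cring ?R by (rule cring_poly_ring)
  have sub: "(supported M :: ('v, 'k) mpoly set) \<subseteq> carrier ?R"
    using assms by (simp add: carrier_poly_ring upclosed_def)
  show "ring ?R" ..
  show "subgroup (supported M) (add_monoid ?R)"
  proof (rule group.subgroupI)
    show "group (add_monoid ?R)" by (rule a_group)
    show "inv\<^bsub>add_monoid ?R\<^esub> f \<in> supported M" if "f \<in> supported M" for f
      using that sub minus_poly_ring[of f A] supported_uminus[of f M]
      unfolding a_inv_def by auto
  qed (use sub supported_0 in \<open>auto simp: supported_add\<close>)
  fix f g :: "('v, 'k) mpoly" assume f: "f \<in> supported M" and g: "g \<in> carrier ?R"
  have "f * g \<in> supported M"
    using f g[unfolded carrier_poly_ring] by (rule supported_mult) (use assms in \<open>auto simp: upclosed_def\<close>)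
  then show "g \<otimes>\<^bsub>?R\<^esub> f \<in> supported M" "f \<otimes>\<^bsub>?R\<^esub> g \<in> supported M"
    by (auto simp: mult.commute)
qed

lemma monom_add: "(monom (m + n) :: ('v, 'k::field) mpoly) = monom m * monom n"
  by (simp add: monom_def mult_single)

lemma genideal_monoms:
  fixes M :: "'v expo set"
  assumes "M \<subseteq> expos A"
  defines "U \<equiv> {m + m' | m m'. m \<in> M \<and> m' \<in> expos A}"
  shows "genideal (poly_ring A :: ('v, 'k::field) mpoly ring) (monom ` M) = supported U"
    and "upclosed A U"
proof -
  let ?R = "poly_ring A :: ('v, 'k) mpoly ring"
  interpret cring ?R by (rule cring_poly_ring)
  have "m + m' + m'' \<in> U" if "m \<in> M" "m' \<in> expos A" "m'' \<in> expos A" for m m' m''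
    using that expos_add[OF that(2,3)] unfolding U_def by (auto simp: add.assoc)
  then show up: "upclosed A U"
    unfolding upclosed_def using assms(1) by (auto simp: U_def dest: expos_add)
  have "(0 :: 'v expo) \<in> expos A" by (simp add: expos_def)
  then have MU: "M \<subseteq> U" unfolding U_def by force
  have carr: "monom ` M \<subseteq> carrier ?R"
    using assms(1) by (auto simp: carrier_poly_ring)
  show "genideal ?R (monom ` M) = supported U"
  proof
    show "genideal ?R (monom ` M) \<subseteq> supported U"
      by (rule genideal_minimal[OF ideal_supported[OF up]]) (use MU in auto)
    interpret I: ideal "genideal ?R (monom ` M)" ?R
      by (rule genideal_ideal[OF carr])
    show "supported U \<subseteq> genideal ?R (monom ` M)"
    proof
      fix f :: "('v, 'k) mpoly" assume f: "f \<in> supported U"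
      have sum: "sum h K \<in> genideal ?R (monom ` M)"
        if "finite K" "\<And>m. m \<in> K \<Longrightarrow> h m \<in> genideal ?R (monom ` M)" for h :: "'v expo \<Rightarrow> ('v, 'k) mpoly" and K
        using that
      proof (induction K rule: finite_induct)
        case empty
        then show ?case using I.zero_closed by simp
      next
        case (insert x K)
        then show ?case using I.a_closed[of "h x" "sum h K"] by auto
      qed
      have "Poly_Mapping.single m (Poly_Mapping.lookup f m) \<in> genideal ?R (monom ` M)"
        if "m \<in> Poly_Mapping.keys f" for m
      proof -
        from that f obtain m0 m1 where m: "m = m0 + m1" "m0 \<in> M" "m1 \<in> expos A"
          unfolding supported_def U_def by blast
        have 1: "monom m0 \<in> genideal ?R (monom ` M)"
          using genideal_self[OF carr] m(2) by blast
        have 2: "Poly_Mapping.single m1 (Poly_Mapping.lookup f m) \<in> carrier ?R"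
          using m(3) by (simp add: carrier_poly_ring single_in_supported)
        have "monom m0 * Poly_Mapping.single m1 (Poly_Mapping.lookup f m) \<in> genideal ?R (monom ` M)"
          using I.I_r_closed[OF 1 2] by simp
        then show ?thesis by (simp add: monom_def mult_single m(1))
      qed
      then show "f \<in> genideal ?R (monom ` M)"
        using sum[of "Poly_Mapping.keys f" "\<lambda>m. Poly_Mapping.single m (Poly_Mapping.lookup f m)"]
        by (simp add: poly_mapping_sum_single)
    qed
  qed
qed

lemma monomial_ideal_iff:
  "monomial_ideal A (J :: ('v, 'k::field) mpoly set) \<longleftrightarrow> (\<exists>M. upclosed A M \<and> J = supported M)"
proof
  assume "monomial_ideal A J"
  then obtain M where "M \<subseteq> expos A" "J = genideal (poly_ring A) (monom ` M)"
    unfolding monomial_ideal_def expos_def by blast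
  then show "\<exists>M. upclosed A M \<and> J = supported M"
    using genideal_monoms[of M A] by blast
next
  assume "\<exists>M. upclosed A M \<and> J = supported M"
  then obtain M where M: "upclosed A M" "J = supported M" by blast
  have "(0 :: 'v expo) \<in> expos A" by (simp add: expos_def)
  then have "{m + m' | m m'. m \<in> M \<and> m' \<in> expos A} = M"
    using M(1) unfolding upclosed_def by force
  then have "J = genideal (poly_ring A) (monom ` M)"
    using M genideal_monoms(1)[of M A] by (auto simp: upclosed_def)
  then show "monomial_ideal A J"
    using M(1) unfolding monomial_ideal_def upclosed_def expos_def by blast
qed

subsection \<open>Stanley-Reisner ideals\<close>

lemma lookup_squarefree_expo:
  "finite S \<Longrightarrow> Poly_Mapping.lookup (squarefree_expo S) a = (if a \<in> S then 1 else 0)"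
  by (simp add: squarefree_expo_def lookup_sum lookup_single when_def)

lemma keys_squarefree_expo [simp]: "finite S \<Longrightarrow> Poly_Mapping.keys (squarefree_expo S) = S"
  by (auto simp: in_keys_iff lookup_squarefree_expo split: if_splits)

lemma squarefree_expo_le:
  "finite S \<Longrightarrow> S \<subseteq> Poly_Mapping.keys m \<Longrightarrow>
    Poly_Mapping.lookup (squarefree_expo S) a \<le> Poly_Mapping.lookup (m :: 'v expo) a"
  by (auto simp: lookup_squarefree_expo in_keys_iff Suc_le_eq)

text \<open>Exponents of the monomials whose support is not a face; they are the monomials of the
  Stanley-Reisner ideal.\<close>

definition nonface_expos :: "'v set set \<Rightarrow> 'v expo set" where
  "nonface_expos X = {m. Poly_Mapping.keys m \<subseteq> vertices X \<and> Poly_Mapping.keys m \<notin> X}"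

lemma finite_vertices: "simplicial_complex X \<Longrightarrow> finite (vertices X)"
  by (auto simp: simplicial_complex_def vertices_def)

lemma stanley_reisner_supported:
  assumes X: "simplicial_complex X"
  shows "stanley_reisner X = (supported (nonface_expos X) :: ('v, 'k::field) mpoly set)"
    and "upclosed (vertices X) (nonface_expos X)"
proof -
  note fin = finite_vertices[OF X]
  have down: "G \<in> X" if "H \<in> X" "G \<subseteq> H" for G H
    using X that by (auto simp: simplicial_complex_def)
  let ?M = "{squarefree_expo S | S. S \<subseteq> vertices X \<and> S \<notin> X}"
  let ?U = "{m + m' | m m'. m \<in> ?M \<and> m' \<in> expos (vertices X)}"
  have "?M \<subseteq> expos (vertices X)"
    using fin finite_subset[OF _ fin] by (force simp: expos_def)
  note gi = genideal_monoms[OF this]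
  have "stanley_reisner X = (genideal (poly_ring (vertices X)) (monom ` ?M) :: ('v, 'k) mpoly set)"
    unfolding stanley_reisner_def by (rule arg_cong[where f = "genideal _"]) blast
  also have "\<dots> = supported ?U" by (rule gi(1))
  also have U: "?U = nonface_expos X"
  proof (intro equalityI subsetI)
    fix m assume "m \<in> ?U"
    then obtain S m' where m: "m = squarefree_expo S + m'" "S \<subseteq> vertices X" "S \<notin> X" "m' \<in> expos (vertices X)"
      by blast
    have "Poly_Mapping.keys m = S \<union> Poly_Mapping.keys m'"
      using fin m(2) by (simp add: m(1) keys_add_expo finite_subset)
    then show "m \<in> nonface_expos X"
      using m down[of "Poly_Mapping.keys m" S] by (auto simp: nonface_expos_def expos_def)
  next
    fix m assume m: "m \<in> nonface_expos X"
    let ?s = "squarefree_expo (Poly_Mapping.keys m)"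
    have "m = ?s + (m - ?s)"
      by (rule expo_le_imp_add) (simp add: squarefree_expo_le)
    moreover have "m - ?s \<in> expos (vertices X)"
      using m by (auto simp: expos_def nonface_expos_def in_keys_iff lookup_minus)
    moreover have "?s \<in> ?M"
      using m by (auto simp: nonface_expos_def)
    ultimately show "m \<in> ?U" by blast
  qed
  finally show "stanley_reisner X = (supported (nonface_expos X) :: ('v, 'k::field) mpoly set)" .
  show "upclosed (vertices X) (nonface_expos X)" using gi(2) unfolding U .
qed

lemma min_generators_supported:
  "min_generators (supported M :: ('v, 'k::field) mpoly set) = {m \<in> M. \<forall>m'\<in>M.
     (\<forall>a. Poly_Mapping.lookup m' a \<le> Poly_Mapping.lookup m a) \<longrightarrow> m' = m}"
  by (auto simp: min_generators_def)

lemma min_generator_containing: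
  assumes X: "simplicial_complex X" and S: "S \<in> X" "insert a S \<notin> X" and a: "a \<in> vertices X"
  shows "\<exists>m\<in>min_generators (stanley_reisner X :: ('v, 'k::field) mpoly set). a \<in> Poly_Mapping.keys m"
proof -
  define P where "P R \<longleftrightarrow> R \<subseteq> insert a S \<and> R \<notin> X" for R
  have "P (insert a S)" using S by (simp add: P_def)
  then obtain R where R: "P R" and min: "\<And>R'. P R' \<Longrightarrow> card R \<le> card R'"
    using exists_least_iff[of "\<lambda>n. \<exists>R. P R \<and> card R = n"] by (metis linorder_not_less)
  have down: "G \<in> X" if "H \<in> X" "G \<subseteq> H" for G H
    using X that by (auto simp: simplicial_complex_def)
  have "finite S" using X S by (auto simp: simplicial_complex_def)
  then have fR: "finite R" using R by (auto simp: P_def intro: finite_subset)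
  have aR: "a \<in> R" using R down[OF S(1), of R] by (auto simp: P_def)
  have RV: "R \<subseteq> vertices X" using R a S(1) by (auto simp: P_def vertices_def)
  have "squarefree_expo R \<in> min_generators (stanley_reisner X :: ('v, 'k) mpoly set)"
    unfolding stanley_reisner_supported(1)[OF X] min_generators_supported
  proof (intro CollectI conjI ballI impI)
    show "squarefree_expo R \<in> nonface_expos X"
      using fR R RV by (simp add: nonface_expos_def P_def)
    fix m assume m: "m \<in> nonface_expos X" "\<forall>b. Poly_Mapping.lookup m b \<le> Poly_Mapping.lookup (squarefree_expo R) b"
    have "Poly_Mapping.keys m \<subseteq> R"
    proof
      fix b assume "b \<in> Poly_Mapping.keys m"
      then have "0 < Poly_Mapping.lookup (squarefree_expo R) b"
        using m(2)[rule_format, of b] by (simp add: in_keys_iff)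
      then show "b \<in> R" using fR by (simp add: lookup_squarefree_expo split: if_splits)
    qed
    moreover from this have "card R \<le> card (Poly_Mapping.keys m)"
      using m(1) R by (intro min) (auto simp: P_def nonface_expos_def)
    ultimately have k: "Poly_Mapping.keys m = R" using fR by (metis card_seteq)
    show "m = squarefree_expo R"
    proof (rule poly_mapping_eqI)
      fix b
      have "b \<in> R \<longleftrightarrow> Poly_Mapping.lookup m b \<noteq> 0" using k by (auto simp: in_keys_iff)
      then show "Poly_Mapping.lookup m b = Poly_Mapping.lookup (squarefree_expo R) b"
        using m(2)[rule_format, of b] fR by (auto simp: lookup_squarefree_expo)
    qed
  qed
  then show ?thesis using aR fR by (intro bexI) auto
qed

subsection \<open>Substitution of variables\<close>

text \<open>The effect of \<^const>\<open>induced_map\<close> on exponents.\<close>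

definition push :: "('v \<Rightarrow> 'w) \<Rightarrow> 'v expo \<Rightarrow> 'w expo" where
  "push p m = (\<Sum>a\<in>Poly_Mapping.keys m. Poly_Mapping.single (p a) (Poly_Mapping.lookup m a))"

lemma push_fixed: "(\<And>c. c \<in> Poly_Mapping.keys m \<Longrightarrow> p c = c) \<Longrightarrow> push p m = m"
  unfolding push_def by (simp add: poly_mapping_sum_single)

lemma lookup_push:
  "Poly_Mapping.lookup (push p m) b = (\<Sum>a\<in>{a \<in> Poly_Mapping.keys m. p a = b}. Poly_Mapping.lookup m a)"
  by (simp add: push_def lookup_sum lookup_single when_def sum.If_cases Int_def)

lemma keys_push [simp]: "Poly_Mapping.keys (push p m) = p ` Poly_Mapping.keys m"
  by (auto simp: in_keys_iff lookup_push)

lemma push_push: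
  assumes inj: "inj_on p (Poly_Mapping.keys m)"
  shows "push p' (push p m) = push (p' \<circ> p) m"
proof -
  have "Poly_Mapping.lookup (push p m) (p a) = Poly_Mapping.lookup m a" if a: "a \<in> Poly_Mapping.keys m" for a
  proof -
    have "{c \<in> Poly_Mapping.keys m. p c = p a} = {a}" using a inj by (auto dest: inj_onD)
    then show ?thesis by (simp add: lookup_push)
  qed
  then show ?thesis
    unfolding push_def[of p' "push p m"] push_def[of "p' \<circ> p"] keys_push sum.reindex[OF inj] by simp
qed

lemma monom_sum: "(monom (sum f S) :: ('v, 'k::field) mpoly) = (\<Prod>i\<in>S. monom (f i))"
  by (induction S rule: infinite_finite_induct) (simp_all add: monom_add, simp_all add: monom_def)

lemma pvar_power: "(pvar a :: ('v, 'k::field) mpoly) ^ n = monom (Poly_Mapping.single a n)"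
proof (induction n)
  case 0
  then show ?case by (simp add: monom_def)
next
  case (Suc n)
  then show ?case
    by (simp add: pvar_def monom_add[symmetric] single_add[symmetric])
qed

lemma induced_map_push:
  "induced_map p (f :: ('v, 'k::field) mpoly) =
     (\<Sum>m\<in>Poly_Mapping.keys f. Poly_Mapping.single (push p m) (Poly_Mapping.lookup f m))"
  unfolding induced_map_def pvar_power monom_sum[symmetric] push_def[symmetric]
  by (simp add: monom_def mult_single)

lemma induced_map_supported:
  "induced_map p ` (supported M :: ('v, 'k::field) mpoly set) = (supported (push p ` M) :: ('w, 'k) mpoly set)"
proof (intro equalityI subsetI)
  fix g :: "('w, 'k) mpoly" assume "g \<in> induced_map p ` (supported M :: ('v, 'k) mpoly set)"
  then obtain f :: "('v, 'k) mpoly" where f: "f \<in> supported M" "g = induced_map p f" by blast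
  show "g \<in> supported (push p ` M)"
    unfolding f(2) induced_map_push using f(1)
    by (intro supported_sum single_in_supported) (auto simp: supported_def)
next
  fix g :: "('w, 'k) mpoly" assume g: "g \<in> supported (push p ` M)"
  then have "\<forall>n\<in>Poly_Mapping.keys g. \<exists>m\<in>M. push p m = n"
    by (auto simp: supported_def)
  then obtain l where l: "\<And>n. n \<in> Poly_Mapping.keys g \<Longrightarrow> l n \<in> M \<and> push p (l n) = n"
    by metis
  define f where "f = (\<Sum>n\<in>Poly_Mapping.keys g. Poly_Mapping.single (l n) (Poly_Mapping.lookup g n))"
  have inj: "inj_on l (Poly_Mapping.keys g)"
    by (rule inj_onI) (metis l)
  have lf: "Poly_Mapping.lookup f (l n) = Poly_Mapping.lookup g n" if n: "n \<in> Poly_Mapping.keys g" for n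
  proof -
    have "Poly_Mapping.lookup f (l n) =
        (\<Sum>n'\<in>Poly_Mapping.keys g. if n' = n then Poly_Mapping.lookup g n' else 0)"
      unfolding f_def lookup_sum lookup_single when_def
      by (rule sum.cong) (use inj n in \<open>auto dest: inj_onD\<close>)
    then show ?thesis using n by (simp add: sum.delta)
  qed
  have kf: "Poly_Mapping.keys f = l ` Poly_Mapping.keys g"
  proof
    have "f \<in> supported (l ` Poly_Mapping.keys g)"
      unfolding f_def by (intro supported_sum single_in_supported) auto
    then show "Poly_Mapping.keys f \<subseteq> l ` Poly_Mapping.keys g" by (simp add: supported_def)
    show "l ` Poly_Mapping.keys g \<subseteq> Poly_Mapping.keys f"
      using lf by (auto simp: in_keys_iff)
  qed
  have "induced_map p f = (\<Sum>n\<in>Poly_Mapping.keys g. Poly_Mapping.single n (Poly_Mapping.lookup g n))"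
    unfolding induced_map_push kf using inj l lf by (simp add: sum.reindex)
  then have "induced_map p f = g" by (simp add: poly_mapping_sum_single)
  moreover have "f \<in> supported M" using kf l by (auto simp: supported_def)
  ultimately show "g \<in> induced_map p ` (supported M :: ('v, 'k) mpoly set)" by blast
qed

subsection \<open>Differences of variables as non-zero divisors\<close>

lemma nonzero_divisor_quot_iff:
  assumes "cring R" "ideal J R" "x \<in> carrier R"
  shows "nonzero_divisor (R Quot J) (J +>\<^bsub>R\<^esub> x) \<longleftrightarrow> (\<forall>f\<in>carrier R. x \<otimes>\<^bsub>R\<^esub> f \<in> J \<longrightarrow> f \<in> J)"
proof -
  interpret cring R by fact
  interpret J: ideal J R by fact
  have carr: "carrier (R Quot J) = {J +>\<^bsub>R\<^esub> f | f. f \<in> carrier R}"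
    by (auto simp: FactRing_def A_RCOSETS_def')
  have zero: "J +>\<^bsub>R\<^esub> f = \<zero>\<^bsub>R Quot J\<^esub> \<longleftrightarrow> f \<in> J" if "f \<in> carrier R" for f
    using that J.a_rcos_const[of f] J.rcos_const_imp_mem[of f] by (auto simp: FactRing_def)
  have mult: "(J +>\<^bsub>R\<^esub> x) \<otimes>\<^bsub>R Quot J\<^esub> (J +>\<^bsub>R\<^esub> f) = J +>\<^bsub>R\<^esub> (x \<otimes>\<^bsub>R\<^esub> f)" if "f \<in> carrier R" for f
    using J.rcoset_mult_add[OF assms(3) that] by (simp add: FactRing_def)
  have "nonzero_divisor (R Quot J) (J +>\<^bsub>R\<^esub> x) \<longleftrightarrow>
      (\<forall>f\<in>carrier R. J +>\<^bsub>R\<^esub> (x \<otimes>\<^bsub>R\<^esub> f) = \<zero>\<^bsub>R Quot J\<^esub> \<longrightarrow> J +>\<^bsub>R\<^esub> f = \<zero>\<^bsub>R Quot J\<^esub>)"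
    unfolding nonzero_divisor_def carr using assms(3) mult by auto
  then show ?thesis using assms(3) by (simp add: zero)
qed

lemma pvar_diff_in_carrier:
  assumes "a1 \<in> A" "a2 \<in> A"
  shows "pvar a1 - pvar a2 \<in> carrier (poly_ring A :: ('v, 'k::field) mpoly ring)"
proof -
  have "(pvar a :: ('v, 'k) mpoly) \<in> supported (expos A)" if "a \<in> A" for a
    using that by (simp add: pvar_def expos_def)
  then show ?thesis
    using assms by (simp add: carrier_poly_ring supported_diff)
qed

text \<open>A monomial that both variables multiply into the ideal is multiplied into it by their
  difference as well.\<close>

lemma nonzero_divisor_monomials:
  assumes "upclosed A M" "a1 \<in> A" "a2 \<in> A"
    and nzd: "nonzero_divisor (poly_ring A Quot (supported M :: ('v, 'k::field) mpoly set))
      (supported M +>\<^bsub>poly_ring A\<^esub> (pvar a1 - pvar a2))"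
    and m: "m \<in> expos A" "Poly_Mapping.single a1 1 + m \<in> M" "Poly_Mapping.single a2 1 + m \<in> M"
  shows "m \<in> M"
proof -
  have "(pvar a1 - pvar a2) * monom m \<in> (supported M :: ('v, 'k) mpoly set)"
    using m(2,3) by (simp add: left_diff_distrib pvar_def monom_add[symmetric] supported_diff)
  moreover have "monom m \<in> (carrier (poly_ring A) :: ('v, 'k) mpoly set)"
    using m(1) by (simp add: carrier_poly_ring)
  ultimately have "(monom m :: ('v, 'k) mpoly) \<in> supported M"
    using nzd nonzero_divisor_quot_iff[OF cring_poly_ring ideal_supported[OF assms(1)]
        pvar_diff_in_carrier[OF assms(2,3)]] by auto
  then show ?thesis by simp
qed

lemma lookup_monom_mult: "Poly_Mapping.lookup (monom t * f :: ('v, 'k::field) mpoly) (t + m) = Poly_Mapping.lookup f m"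
proof -
  have "monom t * f = (\<Sum>n\<in>Poly_Mapping.keys f. Poly_Mapping.single (t + n) (Poly_Mapping.lookup f n))"
    by (subst poly_mapping_sum_single[of f, symmetric])
      (simp add: sum_distrib_left monom_def mult_single)
  then show ?thesis by (simp add: lookup_sum lookup_single when_def sum.delta in_keys_iff)
qed

lemma nonzero_divisor_step:
  fixes f :: "('v, 'k::field) mpoly"
  assumes X: "simplicial_complex X" and ne: "a1 \<noteq> a2"
    and prod: "(pvar a1 - pvar a2) * f \<in> supported (nonface_expos X)"
    and m: "m \<in> Poly_Mapping.keys f" "Poly_Mapping.keys m \<in> X"
  shows "insert a1 (Poly_Mapping.keys m) \<notin> X"
proof -
  have down: "G \<in> X" if "H \<in> X" "G \<subseteq> H" for G H
    using X that by (auto simp: simplicial_complex_def)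
  define K where "K = {m \<in> Poly_Mapping.keys f. Poly_Mapping.keys m \<in> X}"
  define mx where "mx = Max ((\<lambda>m. Poly_Mapping.lookup m a1) ` K)"
  have finK: "finite K" and mK: "m \<in> K" using m by (auto simp: K_def)
  have le: "Poly_Mapping.lookup n a1 \<le> mx" if "n \<in> K" for n
    using that finK by (auto simp: mx_def)
  \<comment> \<open>A face monomial of \<open>f\<close> of maximal degree in \<open>a1\<close> cannot cancel in the product.\<close>
  have max: "insert a1 (Poly_Mapping.keys n) \<notin> X" if n: "n \<in> K" "Poly_Mapping.lookup n a1 = mx" for n
  proof
    assume face: "insert a1 (Poly_Mapping.keys n) \<in> X"
    let ?n = "Poly_Mapping.single a1 1 + n"
    have kn: "Poly_Mapping.keys ?n = insert a1 (Poly_Mapping.keys n)"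
      by (simp add: keys_add_expo)
    have "Poly_Mapping.lookup (pvar a2 * f) ?n = 0"
    proof (rule ccontr)
      assume "Poly_Mapping.lookup (pvar a2 * f) ?n \<noteq> 0"
      then have "?n \<in> Poly_Mapping.keys (pvar a2 * f)" by (simp add: in_keys_iff)
      then obtain n' where n': "n' \<in> Poly_Mapping.keys f" "?n = Poly_Mapping.single a2 1 + n'"
        using keys_mult[of "pvar a2" f] by (auto simp: pvar_def monom_def)
      have "Poly_Mapping.keys n' \<subseteq> Poly_Mapping.keys ?n" by (subst n'(2)) (auto simp: keys_add_expo)
      then have "n' \<in> K" using n'(1) face down kn by (auto simp: K_def)
      have "Poly_Mapping.lookup ?n a1 = Poly_Mapping.lookup n' a1"
        using ne by (subst n'(2)) (simp add: lookup_add lookup_single)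
      then show False using le[OF \<open>n' \<in> K\<close>] n(2) by (simp add: lookup_add)
    qed
    moreover have "Poly_Mapping.lookup (pvar a1 * f) ?n \<noteq> 0"
      using n(1) unfolding pvar_def lookup_monom_mult by (auto simp: K_def in_keys_iff)
    ultimately have "?n \<in> Poly_Mapping.keys ((pvar a1 - pvar a2) * f)"
      by (simp add: in_keys_iff left_diff_distrib lookup_minus)
    then show False using prod face kn by (auto simp: supported_def nonface_expos_def)
  qed
  have "mx \<in> (\<lambda>m. Poly_Mapping.lookup m a1) ` K"
    unfolding mx_def using finK mK by (intro Max_in) auto
  then obtain n where n: "n \<in> K" "Poly_Mapping.lookup n a1 = mx" by auto
  have "a1 \<notin> Poly_Mapping.keys n" using max[OF n] n(1) by (auto simp: K_def insert_absorb)
  then have "mx = 0" using n(2) by (simp add: in_keys_iff)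
  then show ?thesis using max[OF mK] le[OF mK] by simp
qed

lemma nonzero_divisor_stanley_reisner:
  assumes X: "simplicial_complex X" and ne: "a1 \<noteq> a2" "a1 \<in> vertices X" "a2 \<in> vertices X"
    and cover: "\<And>S. S \<in> X \<Longrightarrow> insert a1 S \<in> X \<or> insert a2 S \<in> X"
  shows "nonzero_divisor (poly_ring (vertices X) Quot (stanley_reisner X :: ('v, 'k::field) mpoly set))
      (stanley_reisner X +>\<^bsub>poly_ring (vertices X)\<^esub> (pvar a1 - pvar a2))"
  unfolding stanley_reisner_supported(1)[OF X]
    nonzero_divisor_quot_iff[OF cring_poly_ring ideal_supported[OF stanley_reisner_supported(2)[OF X]]
        pvar_diff_in_carrier[OF ne(2,3)]] poly_ring_simps
proof (intro ballI impI)
  fix f :: "('v, 'k) mpoly"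
  assume f: "f \<in> carrier (poly_ring (vertices X))"
    and prod: "(pvar a1 - pvar a2) * f \<in> supported (nonface_expos X)"
  have "(pvar a2 - pvar a1) * f \<in> supported (nonface_expos X)"
    using supported_uminus[OF prod] by (simp add: algebra_simps)
  then have "Poly_Mapping.keys m \<notin> X" if "m \<in> Poly_Mapping.keys f" for m
    using cover nonzero_divisor_step[OF X ne(1) prod that] nonzero_divisor_step[OF X ne(1)[symmetric] _ that]
    by blast
  then show "f \<in> supported (nonface_expos X)"
    using f by (auto simp: carrier_poly_ring supported_def expos_def nonface_expos_def)
qed

section \<open>Stackings\<close>

text \<open>An enumeration of the facets of a stacked complex, with its recursive structure made explicit:
  the facets \<open>F v\<close> all have \<open>n\<close> elements, \<open>pos\<close> is their order, and each facet \<open>F v\<close> except the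
  first is obtained by attaching the new vertex \<open>x v\<close> to a subset of the earlier facet \<open>F (q v)\<close>.
  Thus \<open>q\<close> makes \<open>V\<close> a rooted tree.\<close>

locale stacking =
  fixes V :: "'i set" and F :: "'i \<Rightarrow> 'v set" and pos :: "'i \<Rightarrow> nat" and root :: 'i
    and q :: "'i \<Rightarrow> 'i" and x :: "'i \<Rightarrow> 'v" and n :: nat
  assumes finite_V: "finite V"
    and inj_pos: "inj_on pos V"
    and root_V: "root \<in> V"
    and finite_F: "v \<in> V \<Longrightarrow> finite (F v)"
    and card_F: "v \<in> V \<Longrightarrow> card (F v) = n"
    and parent_V: "v \<in> V \<Longrightarrow> v \<noteq> root \<Longrightarrow> q v \<in> V"
    and parent_less: "v \<in> V \<Longrightarrow> v \<noteq> root \<Longrightarrow> pos (q v) < pos v"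
    and apex_in: "v \<in> V \<Longrightarrow> v \<noteq> root \<Longrightarrow> x v \<in> F v"
    and ridge_sub: "v \<in> V \<Longrightarrow> v \<noteq> root \<Longrightarrow> F v - {x v} \<subseteq> F (q v)"
    and apex_new: "v \<in> V \<Longrightarrow> v \<noteq> root \<Longrightarrow> t \<in> V \<Longrightarrow> pos t < pos v \<Longrightarrow> x v \<notin> F t"
begin

text \<open>The complex with facets \<open>F v\<close>.\<close>

definition complex :: "'v set set" where
  "complex = generated_complex (F ` V)"

text \<open>The set of facets containing \<open>G\<close>; for ridges \<open>G\<close> that lie in at least two facets these are
  the edges of the hypertree.\<close>

definition star :: "'v set \<Rightarrow> 'i set" where
  "star G = {v \<in> V. G \<subseteq> F v}"

text \<open>The vertex of the parent facet that is dropped when \<open>F v\<close> is attached.\<close>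

definition y :: "'i \<Rightarrow> 'v" where
  "y v = (THE a. a \<in> F (q v) - F v)"

definition edges :: "'i set set" where
  "edges = {star G | G. finite G \<and> card G + 1 = n \<and> card (star G) \<ge> 2}"

lemma parent_induct [consumes 1, case_names root step]:
  assumes "v \<in> V" "P root" "\<And>v. v \<in> V \<Longrightarrow> v \<noteq> root \<Longrightarrow> P (q v) \<Longrightarrow> P v"
  shows "P v"
  using assms(1)
proof (induction "pos v" arbitrary: v rule: less_induct)
  case less
  show ?case
    using less assms(2,3) parent_V parent_less by (cases "v = root") auto
qed

lemma root_less: "v \<in> V \<Longrightarrow> v \<noteq> root \<Longrightarrow> pos root < pos v"
proof (induction v rule: parent_induct)
  case (step v)
  then show ?case using parent_less[of v] by (cases "q v = root") auto
qed simp

lemma pos_cases: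
  assumes "s \<in> V" "t \<in> V" "s \<noteq> t"
  shows "pos s < pos t \<or> pos t < pos s"
  using assms inj_pos by (metis inj_on_def linorder_neqE_nat)

lemma not_root: "s \<in> V \<Longrightarrow> t \<in> V \<Longrightarrow> pos s < pos t \<Longrightarrow> t \<noteq> root"
  using root_less by (cases "s = root") force+

lemma F_neq: "s \<in> V \<Longrightarrow> t \<in> V \<Longrightarrow> s \<noteq> t \<Longrightarrow> F s \<noteq> F t"
  using pos_cases[of s t] apex_new[of s t] apex_new[of t s] apex_in[of s] apex_in[of t]
    not_root[of s t] not_root[of t s] by blast

lemma inj_F: "inj_on F V"
  using F_neq by (meson inj_onI)

lemma F_not_subset: "s \<in> V \<Longrightarrow> t \<in> V \<Longrightarrow> s \<noteq> t \<Longrightarrow> \<not> F s \<subseteq> F t"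
  using F_neq[of s t] card_F finite_F card_subset_eq by metis

lemma n_pos: "v \<in> V \<Longrightarrow> v \<noteq> root \<Longrightarrow> n > 0"
  using apex_in card_F finite_F by (metis card_gt_0_iff empty_iff)

lemma card_ridge: "v \<in> V \<Longrightarrow> v \<noteq> root \<Longrightarrow> card (F v - {x v}) + 1 = n"
  using apex_in card_F finite_F n_pos by (metis Suc_eq_plus1 card_Suc_Diff1)

lemma y_props:
  assumes v: "v \<in> V" "v \<noteq> root"
  shows "F (q v) = insert (y v) (F v - {x v})" "y v \<notin> F v" "x v \<notin> F (q v)"
proof -
  have qv: "q v \<in> V" using parent_V v by blast
  show xq: "x v \<notin> F (q v)" using apex_new parent_less qv v by blast
  have sub: "F v - {x v} \<subseteq> F (q v)" using ridge_sub v by blast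
  have "card (F (q v) - (F v - {x v})) = 1"
    using card_ridge[OF v] card_F[OF qv] finite_F[OF v(1)] sub by (subst card_Diff_subset) auto
  then obtain a where a: "F (q v) - (F v - {x v}) = {a}" by (auto simp: card_1_singleton_iff)
  then have a': "F (q v) - F v = {a}" using xq by auto
  then have "y v = a" unfolding y_def by auto
  then show "F (q v) = insert (y v) (F v - {x v})" "y v \<notin> F v" using a a' sub by auto
qed

lemma y_in: "v \<in> V \<Longrightarrow> v \<noteq> root \<Longrightarrow> y v \<in> F (q v)"
  using y_props(1) by blast

lemma shared_face_in_parent:
  assumes "s \<in> V" "t \<in> V" "pos s < pos t" "G \<subseteq> F s" "G \<subseteq> F t"
  shows "G \<subseteq> F t - {x t}" "G \<subseteq> F (q t)"
proof -
  have t: "t \<noteq> root" using not_root assms by blast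
  show "G \<subseteq> F t - {x t}" using apex_new[OF assms(2) t assms(1,3)] assms by blast
  then show "G \<subseteq> F (q t)" using ridge_sub[OF assms(2) t] by blast
qed

lemma shared_ridge:
  assumes "s \<in> V" "t \<in> V" "pos s < pos t" "G \<subseteq> F s" "G \<subseteq> F t" "card G + 1 = n"
  shows "G = F t - {x t}"
  using shared_face_in_parent(1)[OF assms(1-5)] card_ridge[of t] not_root assms finite_F
  by (metis add_right_cancel card_subset_eq finite_Diff)

lemma ridge_eq_inter:
  assumes "s \<in> V" "t \<in> V" "s \<noteq> t" "G \<subseteq> F s" "G \<subseteq> F t" "card G + 1 = n"
  shows "G = F s \<inter> F t"
proof -
  have "F s \<inter> F t \<subset> F s" using F_not_subset assms by blast
  then have "card (F s \<inter> F t) < n" using finite_F card_F assms psubset_card_mono by metis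
  then show ?thesis
    using assms finite_F by (intro card_seteq) auto
qed

lemma edge_sub: "e \<in> edges \<Longrightarrow> e \<subseteq> V"
  by (auto simp: edges_def star_def)

lemma edge_eq_star:
  assumes "e \<in> edges" "s \<in> e" "t \<in> e" "s \<noteq> t"
  shows "e = star (F s \<inter> F t)" "card (F s \<inter> F t) + 1 = n"
proof -
  obtain G where G: "e = star G" "card G + 1 = n" using assms(1) by (auto simp: edges_def)
  then have "G = F s \<inter> F t" using assms by (intro ridge_eq_inter) (auto simp: star_def)
  then show "e = star (F s \<inter> F t)" "card (F s \<inter> F t) + 1 = n" using G by auto
qed

lemma edges_meet:
  assumes "e \<in> edges" "f \<in> edges" "s \<in> e" "t \<in> e" "s \<in> f" "t \<in> f" "s \<noteq> t"
  shows "e = f"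
  using edge_eq_star(1)[OF assms(1,3,4,7)] edge_eq_star(1)[OF assms(2,5,6,7)] by simp

lemma edge_two:
  assumes "e \<in> edges"
  obtains s t where "s \<in> e" "t \<in> e" "s \<noteq> t"
proof -
  have "\<exists>s t. s \<in> e \<and> t \<in> e \<and> s \<noteq> t"
    using assms card_le_Suc0_iff_eq[OF finite_subset[OF edge_sub[OF assms] finite_V]]
    by (force simp: edges_def)
  then show thesis using that by blast
qed

text \<open>The edge of the ridge along which \<open>F v\<close> is attached; it joins \<open>v\<close> to \<open>q v\<close>.\<close>

definition parent_edge :: "'i \<Rightarrow> 'i set" where
  "parent_edge v = star (F v - {x v})"

lemma parent_edge:
  assumes "v \<in> V" "v \<noteq> root"
  shows "parent_edge v \<in> edges" "v \<in> parent_edge v" "q v \<in> parent_edge v"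
proof -
  show 1: "v \<in> parent_edge v" "q v \<in> parent_edge v"
    using assms ridge_sub parent_V by (auto simp: parent_edge_def star_def)
  have "v \<noteq> q v" using parent_less[OF assms] by auto
  have "finite (parent_edge v)" using finite_V by (simp add: parent_edge_def star_def)
  then have "card {v, q v} \<le> card (parent_edge v)" using 1 by (intro card_mono) auto
  then have "card (parent_edge v) \<ge> 2" using \<open>v \<noteq> q v\<close> by simp
  then show "parent_edge v \<in> edges"
    using assms finite_F card_ridge unfolding edges_def parent_edge_def by auto
qed

lemma edge_parent:
  assumes e: "e \<in> edges" "s \<in> e" "t \<in> e" "pos s < pos t"
  shows "e = parent_edge t"
proof -
  have "s \<noteq> t" "s \<in> V" "t \<in> V" using e edge_sub by auto
  note st = edge_eq_star[OF e(1,2,3) this(1)]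
  have "F s \<inter> F t = F t - {x t}"
    using st(2) \<open>s \<in> V\<close> \<open>t \<in> V\<close> e(4) by (intro shared_ridge) auto
  then show ?thesis using st(1) by (simp add: parent_edge_def)
qed

subsection \<open>The hypertree of a stacking\<close>

text \<open>In a cycle, look at the latest facet \<open>F (v i)\<close>. Both of its neighbours share with it the ridge
  along which it was attached, so that the triple around it lies in one edge. If this is the closing
  triple, then for \<open>n = 3\<close> the triple is excluded anyway, and otherwise the cycle can be shortened by
  removing \<open>v 0\<close>.\<close>

lemma no_hcycle: "\<not> is_hcycle (V, edges) m v"
proof (induction m arbitrary: v)
  case 0
  then show ?case by (simp add: is_hcycle_def)
next
  case (Suc m)
  show ?case
  proof
    assume cyc: "is_hcycle (V, edges) (Suc m) v"
    have pairs: "\<forall>i. 1 \<le> i \<and> i \<le> Suc m \<longrightarrow> (\<exists>e\<in>edges. {v (i - 1), v i} \<subseteq> e)"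
      and triples: "\<forall>i. 1 \<le> i \<and> i < Suc m \<longrightarrow> \<not> (\<exists>e\<in>edges. {v (i - 1), v i, v (i + 1)} \<subseteq> e)"
      using cyc unfolding is_hcycle_def fst_conv snd_conv by blast+
    have m: "m \<ge> 2" and V: "\<And>i. i \<le> Suc m \<Longrightarrow> v i \<in> V" and inj: "inj_on v {..m}"
      and cl: "v (Suc m) = v 0"
      and pair: "\<And>i. i \<le> m \<Longrightarrow> \<exists>e\<in>edges. v i \<in> e \<and> v (Suc i) \<in> e"
      and triple: "\<And>i e. i < m \<Longrightarrow> e \<in> edges \<Longrightarrow> v i \<in> e \<Longrightarrow> v (Suc i) \<in> e \<Longrightarrow> v (Suc (Suc i)) \<in> e \<Longrightarrow> False"
    proof -
      show "\<exists>e\<in>edges. v i \<in> e \<and> v (Suc i) \<in> e" if "i \<le> m" for i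
        using pairs[rule_format, of "Suc i"] that by simp
      show False if "i < m" "e \<in> edges" "v i \<in> e" "v (Suc i) \<in> e" "v (Suc (Suc i)) \<in> e" for i e
        using triples[rule_format, of "Suc i"] that by auto
    qed (use cyc in \<open>auto simp: is_hcycle_def lessThan_Suc_atMost\<close>)
    have dist: "v i \<noteq> v j" if "i \<le> m" "j \<le> m" "i \<noteq> j" for i j
      using inj that by (auto dest: inj_onD)
    obtain i where i: "i \<le> m" "\<And>j. j \<le> m \<Longrightarrow> pos (v j) \<le> pos (v i)"
    proof -
      have "finite ((\<lambda>j. pos (v j)) ` {..m})" "(\<lambda>j. pos (v j)) ` {..m} \<noteq> {}" by auto
      from Max_in[OF this] obtain i where "i \<le> m" "Max ((\<lambda>j. pos (v j)) ` {..m}) = pos (v i)"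
        unfolding image_iff by auto
      then show thesis using that[of i] Max_ge[of "(\<lambda>j. pos (v j)) ` {..m}"] by fastforce
    qed
    have less: "pos (v j) < pos (v i)" if "j \<le> m" "j \<noteq> i" for j
      using i(2)[OF that(1)] pos_cases[of "v j" "v i"] V i(1) that dist by (metis le_Suc_eq linorder_not_less)
    show False
    proof (cases "i = 0")
      case False
      then obtain j where j: "i = Suc j" by (cases i) auto
      obtain e where e: "e \<in> edges" "v j \<in> e" "v i \<in> e" using pair[of j] i j by auto
      obtain f where f: "f \<in> edges" "v i \<in> f" "v (Suc i) \<in> f" using pair[of i] i by auto
      have "e = parent_edge (v i)"
        using edge_parent[OF e] less[of j] i j by auto
      moreover have "pos (v (Suc i)) < pos (v i)"
        using less[of "Suc i"] less[of 0] False i(1) cl by (cases "i = m") auto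
      then have "f = parent_edge (v i)" using edge_parent[OF f(1,3,2)] by auto
      ultimately show False using triple[of j e] e f i j by auto
    next
      case True
      obtain e where e: "e \<in> edges" "v 0 \<in> e" "v 1 \<in> e" using pair[of 0] by auto
      obtain f where f: "f \<in> edges" "v m \<in> f" "v 0 \<in> f" using pair[of m] cl by auto
      have "e = parent_edge (v 0)" "f = parent_edge (v 0)"
        using edge_parent[OF e(1,3,2)] edge_parent[OF f] less[of 1] less[of m] True m by auto
      then have ef: "e = f" by simp
      show False
      proof (cases "m = 2")
        case True
        then show False using triple[of 0 e] e f ef by (auto simp: numeral_2_eq_2)
      next
        case False
        then have m3: "m \<ge> 3" using m by simp
        define w where "w j = (if j = m then v 1 else v (Suc j))" for j
        have "is_hcycle (V, edges) m w"
          unfolding is_hcycle_def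
        proof (intro conjI allI impI)
          show "3 \<le> m" by fact
          show "w j \<in> hverts (V, edges)" if "j \<le> m" for j
            using V[of 1] V[of "Suc j"] that m by (simp add: w_def)
          show "inj_on w {..<m}"
          proof (rule inj_onI)
            fix j k assume "j \<in> {..<m}" "k \<in> {..<m}" "w j = w k"
            then show "j = k" using dist[of "Suc j" "Suc k"] by (auto simp: w_def)
          qed
          show "w m = w 0" using m by (simp add: w_def)
          show "\<exists>e\<in>hedges (V, edges). {w (j - 1), w j} \<subseteq> e" if "1 \<le> j \<and> j \<le> m" for j
          proof (cases "j = m")
            case True
            then have "w (j - 1) = v m" "w j = v 1" using m by (auto simp: w_def)
            then show ?thesis using e f ef by (intro bexI[of _ e]) auto
          next
            case False
            then have "w (j - 1) = v j" "w j = v (Suc j)" using that by (auto simp: w_def)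
            then show ?thesis using pair[of j] that by auto
          qed
          show "\<not> (\<exists>e\<in>hedges (V, edges). {w (j - 1), w j, w (j + 1)} \<subseteq> e)" if j: "1 \<le> j \<and> j < m" for j
          proof (cases "j + 1 = m")
            case False
            then have "w (j - 1) = v j" "w j = v (Suc j)" "w (j + 1) = v (Suc (Suc j))"
              using j by (auto simp: w_def)
            then show ?thesis using triple[of j] j by auto
          next
            case True
            show ?thesis
            proof
              assume "\<exists>g\<in>hedges (V, edges). {w (j - 1), w j, w (j + 1)} \<subseteq> g"
              moreover have "w (j - 1) = v j" "w j = v m" "w (j + 1) = v 1"
                using True j by (auto simp: w_def)
              ultimately obtain g where g: "g \<in> edges" "v j \<in> g" "v m \<in> g" "v 1 \<in> g"
                by auto
              have "v m \<noteq> v 1" using dist m by auto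
              then have "g = f" using edges_meet[OF g(1) f(1) g(3,4) f(2)] e ef by auto
              then show False using triple[of j f] g f cl True by auto
            qed
          qed
        qed
        then show False using Suc.IH by blast
      qed
    qed
  qed
qed

lemma path_to_root:
  assumes "v \<in> V" "v \<noteq> root"
  shows "\<exists>es. es \<noteq> [] \<and> set es \<subseteq> edges \<and> v \<in> hd es \<and> root \<in> last es \<and>
           successively (\<lambda>e f. e \<inter> f \<noteq> {}) es"
  using assms
proof (induction v rule: parent_induct)
  case (step v)
  note pe = parent_edge[OF step.hyps]
  show ?case
  proof (cases "q v = root")
    case True
    then show ?thesis using pe by (intro exI[of _ "[parent_edge v]"]) auto
  next
    case False
    from step.IH[OF False] obtain es where es: "es \<noteq> []" "set es \<subseteq> edges" "q v \<in> hd es" "root \<in> last es"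
      "successively (\<lambda>e f. e \<inter> f \<noteq> {}) es" by blast
    have "parent_edge v \<inter> hd es \<noteq> {}" using es(3) pe(3) by blast
    then show ?thesis
      using es pe by (intro exI[of _ "parent_edge v # es"]) (auto simp: successively_Cons)
  qed
qed simp

lemma hypertree_edges: "hypertree (V, edges)"
  unfolding hypertree_def
proof (intro conjI)
  show "hypergraph (V, edges)"
    unfolding hypergraph_def fst_conv snd_conv
  proof (intro conjI ballI impI)
    fix e f assume ef: "e \<in> edges" "f \<in> edges" "e \<subseteq> f"
    obtain s t where "s \<in> e" "t \<in> e" "s \<noteq> t" using edge_two ef(1) by blast
    then show "e = f" using edges_meet ef by blast
  qed (use edge_sub in auto)
  show "\<forall>e\<in>hedges (V, edges). \<forall>f\<in>hedges (V, edges). e \<noteq> f \<longrightarrow> (\<forall>x\<in>e \<inter> f. \<forall>y\<in>e \<inter> f. x = y)"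
    using edges_meet by auto
  show "\<not> (\<exists>n v. is_hcycle (V, edges) n v)" using no_hcycle by blast
  show "hconnected (V, edges)"
    unfolding hconnected_def fst_conv snd_conv
  proof (intro ballI impI)
    fix v w assume vw: "v \<in> V" "w \<in> V" "v \<noteq> w"
    let ?P = "\<lambda>v w es. es \<noteq> [] \<and> set es \<subseteq> edges \<and> v \<in> hd es \<and> w \<in> last es \<and>
           successively (\<lambda>e f. e \<inter> f \<noteq> {}) es"
    have sym: "?P w v (rev es)" if "?P v w es" for v w es
    proof -
      have "successively (\<lambda>e f. f \<inter> e \<noteq> {}) es"
        using that by (auto simp: Int_commute intro: successively_mono)
      then show ?thesis using that unfolding successively_rev by (simp add: hd_rev last_rev)
    qed
    consider "v = root" | "w = root" | "v \<noteq> root" "w \<noteq> root" by blast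
    then show "\<exists>es. ?P v w es"
    proof cases
      case 1
      then obtain es where "?P w v es" using path_to_root[of w] vw by blast
      then show ?thesis using sym by blast
    next
      case 2
      then show ?thesis using path_to_root[of v] vw by blast
    next
      case 3
      obtain es where es: "?P v root es" using path_to_root[of v] vw 3 by blast
      obtain fs where fs: "?P w root fs" using path_to_root[of w] vw 3 by blast
      have "?P root w (rev fs)" using sym[OF fs] .
      then have "?P v w (es @ rev fs)"
        using es by (auto simp: successively_append_iff)
      then show ?thesis by blast
    qed
  qed
qed

subsection \<open>The stacked complex of a stacking\<close>

lemma in_complex: "S \<in> complex \<longleftrightarrow> (\<exists>v\<in>V. S \<subseteq> F v)"
  by (auto simp: complex_def generated_complex_def)

lemma vertices_complex: "vertices complex = (\<Union>v\<in>V. F v)"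
  by (fastforce simp: vertices_def in_complex)

lemma simplicial_complex: "simplicial_complex complex"
proof -
  have "complex \<subseteq> Pow (\<Union>v\<in>V. F v)" by (fastforce simp: in_complex)
  moreover have "finite (\<Union>v\<in>V. F v)" using finite_V finite_F by auto
  ultimately have "finite complex" by (meson finite_Pow_iff finite_subset)
  then show ?thesis
    unfolding simplicial_complex_def using in_complex finite_F finite_subset by (meson order_trans)
qed

lemma facets_complex: "facets complex = F ` V"
proof
  show "facets complex \<subseteq> F ` V"
  proof
    fix S assume S: "S \<in> facets complex"
    then obtain v where v: "v \<in> V" "S \<subseteq> F v" by (auto simp: facets_def in_complex)
    moreover have "F v \<in> complex" using v by (auto simp: in_complex)
    ultimately show "S \<in> F ` V" using S by (auto simp: facets_def)
  qed
  show "F ` V \<subseteq> facets complex"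
  proof clarsimp
    fix v assume v: "v \<in> V"
    have "G = F v" if "G \<in> complex" "F v \<subseteq> G" for G
    proof -
      obtain w where w: "w \<in> V" "G \<subseteq> F w" using \<open>G \<in> complex\<close> by (auto simp: in_complex)
      then have "v = w" using F_not_subset[OF v w(1)] that by blast
      then show ?thesis using w that by blast
    qed
    then show "F v \<in> facets complex" using v by (auto simp: facets_def in_complex)
  qed
qed

lemma facet_indexing: "facet_indexing complex V F"
  by (simp add: facet_indexing_def bij_betw_def inj_F facets_complex)

lemma dim_complex: "complex_dim complex = int n - 1"
  unfolding complex_dim_def
proof (rule Max_eqI)
  show "finite ((\<lambda>F. int (card F) - 1) ` complex)"
    using simplicial_complex by (simp add: simplicial_complex_def)
  show "int n - 1 \<in> (\<lambda>F. int (card F) - 1) ` complex"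
    using root_V card_F in_complex by (intro image_eqI[of _ _ "F root"]) auto
  fix k assume "k \<in> (\<lambda>F. int (card F) - 1) ` complex"
  then obtain S v where "k = int (card S) - 1" "v \<in> V" "S \<subseteq> F v" by (auto simp: in_complex)
  then show "k \<le> int n - 1" using card_mono[OF finite_F, of v S] card_F[of v] by simp
qed

lemma assoc_hypertree_complex: "assoc_hypertree complex V F = (V, edges)"
proof -
  have "(\<exists>G\<in>complex. int (card G) - 1 = int n - 1 - 1 \<and> e = {v \<in> V. G \<subseteq> F v} \<and> 2 \<le> card e) \<longleftrightarrow>
      e \<in> edges" for e
  proof
    assume "\<exists>G\<in>complex. int (card G) - 1 = int n - 1 - 1 \<and> e = {v \<in> V. G \<subseteq> F v} \<and> 2 \<le> card e"
    then obtain G where G: "G \<in> complex" "int (card G) - 1 = int n - 1 - 1" "e = star G" "2 \<le> card e"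
      unfolding star_def by blast
    have "finite G" using G(1) simplicial_complex by (auto simp: simplicial_complex_def)
    then show "e \<in> edges" using G by (auto simp: edges_def)
  next
    assume "e \<in> edges"
    then obtain G where G: "e = star G" "card G + 1 = n" "2 \<le> card e" unfolding edges_def by blast
    from G(3) have "e \<noteq> {}" by auto
    then have "G \<in> complex" using G(1) by (auto simp: star_def in_complex)
    then show "\<exists>G\<in>complex. int (card G) - 1 = int n - 1 - 1 \<and> e = {v \<in> V. G \<subseteq> F v} \<and> 2 \<le> card e"
      using G by (intro bexI[of _ G]) (auto simp: star_def)
  qed
  then show ?thesis unfolding assoc_hypertree_def dim_complex by auto
qed

lemma stacked_complex: "stacked complex"
  unfolding stacked_def
proof (intro conjI)
  show "simplicial_complex complex" by (rule simplicial_complex)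
  show "pure complex" by (auto simp: pure_def facets_complex card_F)
  define Ps where "Ps = sorted_list_of_set (pos ` V)"
  define Vs where "Vs = map (the_inv_into V pos) Ps"
  have Ps: "set Ps = pos ` V" "sorted_wrt (<) Ps" using finite_V by (auto simp: Ps_def)
  have inv: "the_inv_into V pos ` pos ` V = V"
    using inj_pos by (simp add: image_image the_inv_into_f_f)
  have set_Vs: "set Vs = V" by (simp add: Vs_def Ps inv)
  have pos_Vs: "pos (Vs ! i) = Ps ! i" if "i < length Vs" for i
    using that Ps(1) nth_mem[of i Ps] inj_pos by (auto simp: Vs_def intro!: f_the_inv_into_f)
  have less: "pos (Vs ! i) < pos (Vs ! j)" if "i < j" "j < length Vs" for i j
    using sorted_wrt_nth_less[OF Ps(2), of i j] that pos_Vs by (simp add: Vs_def)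
  have dist: "distinct Vs"
    unfolding distinct_conv_nth using less by (metis less_irrefl linorder_neqE_nat)
  show "\<exists>Fs. Fs \<noteq> [] \<and> distinct Fs \<and> set Fs = facets complex \<and>
        (\<forall>p. 1 \<le> p \<and> p < length Fs \<longrightarrow>
           (let Y = generated_complex (set (take p Fs))
            in \<exists>G v. Fs ! p = G \<union> {v} \<and> G \<in> Y \<and> v \<notin> vertices Y))"
  proof (intro exI[of _ "map F Vs"] conjI allI impI)
    show "map F Vs \<noteq> []" using set_Vs root_V by auto
    show "distinct (map F Vs)" by (simp add: distinct_map dist set_Vs inj_F)
    show "set (map F Vs) = facets complex" by (simp add: set_Vs facets_complex)
    fix p assume p: "1 \<le> p \<and> p < length (map F Vs)"
    define v where "v = Vs ! p"
    have v: "v \<in> V" using p set_Vs by (auto simp: v_def)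
    have "0 < length Vs" using p by auto
    then have "Vs ! 0 \<in> V" using set_Vs nth_mem by blast
    moreover have "pos (Vs ! 0) < pos v" using p less[of 0 p] by (auto simp: v_def)
    ultimately have nr: "v \<noteq> root" using not_root v by blast
    have before: "set (take p Vs) = {t \<in> V. pos t < pos v}"
    proof (intro equalityI subsetI)
      fix t assume "t \<in> set (take p Vs)"
      then obtain i where "i < p" "t = Vs ! i" using p by (auto simp: in_set_conv_nth)
      then show "t \<in> {t \<in> V. pos t < pos v}"
        using less[of i p] p set_Vs nth_mem[of i Vs] by (simp add: v_def)
    next
      fix t assume t: "t \<in> {t \<in> V. pos t < pos v}"
      then obtain i where i: "i < length Vs" "t = Vs ! i" using set_Vs by (auto simp: in_set_conv_nth)
      have "i < p"
      proof (rule ccontr)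
        assume "\<not> i < p"
        then have "pos v \<le> pos t" using less[of p i] i by (cases "i = p") (auto simp: v_def)
        then show False using t by simp
      qed
      then show "t \<in> set (take p Vs)" using i p by (auto simp: in_set_conv_nth)
    qed
    have st: "set (take p (map F Vs)) = F ` {t \<in> V. pos t < pos v}"
      by (simp add: take_map before)
    have "F v = (F v - {x v}) \<union> {x v}" using apex_in[OF v nr] by blast
    moreover have "F v - {x v} \<in> generated_complex (set (take p (map F Vs)))"
      using ridge_sub[OF v nr] parent_V[OF v nr] parent_less[OF v nr]
      unfolding st generated_complex_def by blast
    moreover have "x v \<notin> vertices (generated_complex (set (take p (map F Vs))))"
      using apex_new[OF v nr] unfolding st generated_complex_def vertices_def by blast
    moreover have "map F Vs ! p = F v" using p by (simp add: v_def)
    ultimately show "let Y = generated_complex (set (take p (map F Vs)))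
            in \<exists>G v. map F Vs ! p = G \<union> {v} \<and> G \<in> Y \<and> v \<notin> vertices Y"
      unfolding Let_def by metis
  qed
qed

end

lemma stacked_imp_stacking:
  assumes X: "stacked X" and ind: "facet_indexing X V F"
  shows "\<exists>pos root q x n. stacking V F pos root q x n"
    and "X = stacking.complex V F"
proof -
  have sc: "simplicial_complex X" and pure: "pure X" using X by (auto simp: stacked_def)
  obtain Fs where Fs: "Fs \<noteq> []" "distinct Fs" "set Fs = facets X"
    and step: "\<And>p. 1 \<le> p \<Longrightarrow> p < length Fs \<Longrightarrow> \<exists>G v. Fs ! p = G \<union> {v} \<and>
       G \<in> generated_complex (set (take p Fs)) \<and> v \<notin> vertices (generated_complex (set (take p Fs)))"
    using X unfolding stacked_def Let_def by blast
  have inj: "inj_on F V" and img: "F ` V = facets X"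
    using ind by (auto simp: facet_indexing_def bij_betw_def)
  have "\<forall>v\<in>V. \<exists>i<length Fs. Fs ! i = F v"
    using img Fs(3) by (metis image_eqI in_set_conv_nth)
  then obtain pos where pos: "\<And>v. v \<in> V \<Longrightarrow> pos v < length Fs \<and> Fs ! (pos v) = F v" by metis
  define idx where "idx i = (THE v. v \<in> V \<and> F v = Fs ! i)" for i
  have idx: "idx i \<in> V" "F (idx i) = Fs ! i" "pos (idx i) = i" if "i < length Fs" for i
  proof -
    have "Fs ! i \<in> F ` V" using that img Fs(3) by auto
    then have "\<exists>!v. v \<in> V \<and> F v = Fs ! i" using inj by (auto dest: inj_onD)
    from theI'[OF this] show 1: "idx i \<in> V" "F (idx i) = Fs ! i" by (auto simp: idx_def)
    show "pos (idx i) = i" using pos[OF 1(1)] 1(2) that Fs(2) nth_eq_iff_index_eq by metis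
  qed
  have idx_pos: "idx (pos v) = v" if "v \<in> V" for v
    using pos[OF that] idx[of "pos v"] inj that by (auto dest: inj_onD)
  define root where "root = idx 0"
  have root: "root \<in> V" "pos root = 0" using idx[of 0] Fs(1) by (auto simp: root_def)
  have "\<exists>u a. u \<in> V \<and> pos u < pos v \<and> a \<in> F v \<and> F v - {a} \<subseteq> F u \<and> (\<forall>t\<in>V. pos t < pos v \<longrightarrow> a \<notin> F t)"
    if v: "v \<in> V" "v \<noteq> root" for v
  proof -
    have "pos v \<noteq> 0"
    proof
      assume "pos v = 0"
      then show False using v(2) idx_pos[OF v(1)] by (simp add: root_def)
    qed
    then obtain G a where G: "F v = G \<union> {a}" "G \<in> generated_complex (set (take (pos v) Fs))"
      "a \<notin> vertices (generated_complex (set (take (pos v) Fs)))"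
      using step[of "pos v"] pos[OF v(1)] by auto
    obtain i where i: "i < pos v" "G \<subseteq> Fs ! i"
      using G(2) pos[OF v(1)] by (auto simp: generated_complex_def in_set_conv_nth)
    have il: "i < length Fs" using i pos[OF v(1)] by simp
    have "a \<notin> F t" if "t \<in> V" "pos t < pos v" for t
    proof -
      have "F t \<in> set (take (pos v) Fs)"
        using pos[OF that(1)] pos[OF v(1)] that(2) by (metis in_set_conv_nth length_take min.absorb4 nth_take)
      then show ?thesis using G(3) by (auto simp: generated_complex_def vertices_def)
    qed
    then show ?thesis
      using idx[OF il] i G(1) by (intro exI[of _ "idx i"] exI[of _ a]) auto
  qed
  then obtain q x where qx: "\<And>v. v \<in> V \<Longrightarrow> v \<noteq> root \<Longrightarrow> q v \<in> V \<and> pos (q v) < pos v \<and> x v \<in> F v \<and>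
      F v - {x v} \<subseteq> F (q v) \<and> (\<forall>t\<in>V. pos t < pos v \<longrightarrow> x v \<notin> F t)"
    by metis
  have sub: "facets X \<subseteq> X" by (auto simp: facets_def)
  have st: "stacking V F pos root q x (card (F root))"
  proof
    show "finite V" using inj img Fs(3) by (metis List.finite_set finite_imageD)
    show "inj_on pos V" using idx_pos by (metis inj_onI)
    show "finite (F v)" if "v \<in> V" for v
      using that img sub sc unfolding simplicial_complex_def by blast
    show "card (F v) = card (F root)" if "v \<in> V" for v
      using that img pure root(1) unfolding pure_def by blast
  qed (use root qx in auto)
  then show "\<exists>pos root q x n. stacking V F pos root q x n" by blast
  interpret stacking V F pos root q x "card (F root)" by (rule st)
  show "X = stacking.complex V F"
  proof (intro equalityI subsetI)
    fix S assume "S \<in> stacking.complex V F"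
    then obtain v where "v \<in> V" "S \<subseteq> F v" unfolding in_complex by blast
    moreover from this have "F v \<in> X" using img sub by blast
    ultimately show "S \<in> X" using sc unfolding simplicial_complex_def by blast
  next
    fix S assume S: "S \<in> X"
    have "finite X" using sc by (simp add: simplicial_complex_def)
    then obtain H where "H \<in> X" "S \<subseteq> H" "\<forall>G\<in>X. H \<subseteq> G \<longrightarrow> G = H"
      using finite_has_maximal2[of X S] S by metis
    then have "H \<in> F ` V" "S \<subseteq> H" by (auto simp: img facets_def)
    then show "S \<in> stacking.complex V F" using in_complex by blast
  qed
qed

section \<open>Counting vertices of the hypertree\<close>

context stacking
begin

lemma not_coneD: "\<not> is_cone complex \<Longrightarrow> a \<in> F root \<Longrightarrow> \<exists>v\<in>V. a \<notin> F v"
  using root_V unfolding is_cone_def vertices_complex facets_complex by blast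

text \<open>A vertex of the first facet disappears from the common intersection of the facets at a step
  that drops it.\<close>

lemma first_omission:
  assumes a: "a \<in> F root" and v0: "v0 \<in> V" "a \<notin> F v0"
  shows "\<exists>v\<in>V - {root}. a = y v \<and> a \<notin> F v \<and> (\<forall>t\<in>V. pos t < pos v \<longrightarrow> a \<in> F t)"
proof -
  obtain v where v: "v \<in> V \<and> a \<notin> F v" and min: "\<And>t. t \<in> V \<and> a \<notin> F t \<Longrightarrow> pos v \<le> pos t"
    using ex_has_least_nat[of "\<lambda>v. v \<in> V \<and> a \<notin> F v" v0 pos] v0 by blast
  have nr: "v \<noteq> root" using a v by blast
  have before: "a \<in> F t" if "t \<in> V" "pos t < pos v" for t
    using min[of t] that by force
  have "a \<in> F (q v)" using before parent_V parent_less v nr by blast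
  then have "a = y v" using y_props(1)[of v] v nr by blast
  then show ?thesis using v nr before by blast
qed

lemma card_V_ge:
  assumes "\<not> is_cone complex"
  shows "card V \<ge> n + 1"
proof -
  have "F root \<subseteq> y ` (V - {root})"
    using not_coneD[OF assms] first_omission by blast
  then have "card (F root) \<le> card (y ` (V - {root}))"
    using finite_V by (intro card_mono) auto
  also have "\<dots> \<le> card (V - {root})" using finite_V by (intro card_image_le) auto
  finally show ?thesis
    using card_F[OF root_V] root_V finite_V card_gt_0_iff[of V] by (auto simp: card_Diff_singleton)
qed

text \<open>Attaching a further facet along a ridge that already lies in two facets drops no vertex of the
  first facet that had not been dropped before.\<close>

lemma card_V_ge_of_large_edge:
  assumes "\<not> is_cone complex" "e \<in> edges" "card e \<ge> 3"
  shows "card V \<ge> n + 2"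
proof -
  have fe: "finite e" using edge_sub assms(2) finite_V finite_subset by blast
  have "finite (pos ` e)" "pos ` e \<noteq> {}" using fe assms(3) by auto
  from Max_in[OF this] obtain w where w: "w \<in> e" "pos w = Max (pos ` e)" by auto
  have "card (e - {w}) \<ge> 2" using assms(3) fe w by simp
  then have "\<not> (\<forall>s\<in>e - {w}. \<forall>t\<in>e - {w}. s = t)"
    using card_le_Suc0_iff_eq[of "e - {w}"] fe by simp
  then obtain s t where st: "s \<in> e" "t \<in> e" "s \<noteq> w" "t \<noteq> w" "s \<noteq> t"
    by blast
  have V: "s \<in> V" "t \<in> V" "w \<in> V" using st w edge_sub assms(2) by auto
  have "pos s \<le> pos w" "pos t \<le> pos w" using st w fe by auto
  then have less: "pos s < pos w" "pos t < pos w"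
    using pos_cases[of s w] pos_cases[of t w] V st by auto
  have "F s \<inter> F t \<subseteq> F w"
    using edge_eq_star(1)[OF assms(2) st(1,2,5)] w by (auto simp: star_def)
  have "F root \<subseteq> y ` (V - {root, w})"
  proof
    fix a assume a: "a \<in> F root"
    then obtain v where v: "v \<in> V - {root}" "a = y v" "a \<notin> F v" "\<forall>t\<in>V. pos t < pos v \<longrightarrow> a \<in> F t"
      using not_coneD[OF assms(1)] first_omission by meson
    then have "v \<noteq> w" using less V \<open>F s \<inter> F t \<subseteq> F w\<close> by blast
    then show "a \<in> y ` (V - {root, w})" using v by blast
  qed
  then have "card (F root) \<le> card (y ` (V - {root, w}))"
    using finite_V by (intro card_mono) auto
  also have "\<dots> \<le> card (V - {root, w})" using finite_V by (intro card_image_le) auto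
  also have "\<dots> + 2 = card V"
  proof -
    have "root \<noteq> w" using not_root[OF V(1,3) less(1)] by blast
    then have "card {root, w} = 2" by simp
    moreover have "card {root, w} \<le> card V" using root_V V finite_V by (intro card_mono) auto
    ultimately show ?thesis using root_V V finite_V by (subst card_Diff_subset) auto
  qed
  finally show ?thesis using card_F[OF root_V] by simp
qed

section \<open>Splitting a vertex\<close>

text \<open>The branch of the tree below \<open>r\<close>, including \<open>r\<close>.\<close>

inductive_set desc :: "'i \<Rightarrow> 'i set" for r where
  desc_self: "r \<in> desc r"
| desc_step: "s \<in> V \<Longrightarrow> s \<noteq> root \<Longrightarrow> q s \<in> desc r \<Longrightarrow> s \<in> desc r"

lemma desc_V:
  assumes "r \<in> V" "s \<in> desc r"
  shows "s \<in> V"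
  using assms(2,1) by cases auto

lemma desc_pos: "s \<in> desc r \<Longrightarrow> pos r \<le> pos s"
proof (induction rule: desc.induct)
  case (desc_step s)
  then show ?case using parent_less[of s] by simp
qed simp

lemma desc_parent: "s \<in> V \<Longrightarrow> s \<noteq> root \<Longrightarrow> s \<noteq> r \<Longrightarrow> s \<in> desc r \<longleftrightarrow> q s \<in> desc r"
  using desc.simps[of s r] by blast

lemma root_notin_desc: "r \<in> V \<Longrightarrow> r \<noteq> root \<Longrightarrow> root \<notin> desc r"
  using desc_pos[of root r] root_less[of r] by auto

lemma y_notin_desc:
  assumes r: "r \<in> V" "r \<noteq> root" and s: "s \<in> desc r"
  shows "y r \<notin> F s"
  using s
proof (induction rule: desc.induct)
  case desc_self
  then show ?case using y_props(2) r by blast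
next
  case (desc_step s)
  have "pos (q r) < pos s"
    using parent_less[OF r] parent_less[OF desc_step(1,2)] desc_pos[OF desc_step(3)] by simp
  then have "x s \<notin> F (q r)" using apex_new desc_step(1,2) parent_V r by blast
  then have "y r \<noteq> x s" using y_in[OF r] by auto
  then show ?case using desc_step ridge_sub by blast
qed

text \<open>If there are more than \<open>n + 1\<close> facets, then either some dropped vertex does not lie in the first
  facet, or two attachments drop the same vertex.\<close>

lemma exists_splitting:
  assumes "card V \<ge> n + 2"
  shows "\<exists>r\<in>V - {root}. \<exists>u\<in>V - desc r. y r \<notin> F u"
proof (cases "\<exists>r\<in>V - {root}. y r \<notin> F root")
  case True
  then show ?thesis using root_V root_notin_desc by blast
next
  case False
  then have "y ` (V - {root}) \<subseteq> F root" by blast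
  then have "card (y ` (V - {root})) \<le> n"
    using card_F[OF root_V] finite_F[OF root_V] card_mono by metis
  moreover have "card (V - {root}) = card V - 1" using root_V finite_V by simp
  ultimately have "card (y ` (V - {root})) < card (V - {root})" using assms by simp
  then have "\<not> inj_on y (V - {root})" using card_image by fastforce
  then obtain r t where rt: "r \<in> V - {root}" "t \<in> V - {root}" "y r = y t" "r \<noteq> t"
    by (auto simp: inj_on_def)
  have "pos r < pos t \<or> pos t < pos r" using rt pos_cases by auto
  then show ?thesis
  proof
    assume "pos r < pos t"
    then have "r \<notin> desc t" using desc_pos[of r t] by auto
    moreover have "y t \<notin> F r" using y_props(2)[of r] rt by simp
    ultimately show ?thesis using rt by blast
  next
    assume "pos t < pos r"
    then have "t \<notin> desc r" using desc_pos[of t r] by auto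
    moreover have "y r \<notin> F t" using y_props(2)[of t] rt by simp
    ultimately show ?thesis using rt by blast
  qed
qed

end

text \<open>Removing from the tree the facets that contain \<open>a = y r\<close> leaves the branch \<open>desc r\<close> and the other
  facets. The vertex \<open>a\<close> is split into \<open>a\<close> and a new vertex \<open>b\<close>: facets containing \<open>a\<close> receive both,
  those in the branch receive \<open>b\<close> and the others receive \<open>a\<close>. The facet \<open>F u\<close> witnesses that some
  facet receives only \<open>a\<close>.\<close>

locale splitting = stacking +
  fixes r u :: 'a and b :: 'b
  assumes r_V: "r \<in> V" "r \<noteq> root"
    and u_V: "u \<in> V" "u \<notin> desc r" "y r \<notin> F u"
    and b_new: "v \<in> V \<Longrightarrow> b \<notin> F v"
begin

text \<open>The facets after the splitting, and the new vertices with which they are attached. Where the old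
  facet \<open>F s\<close> brings in \<open>a\<close> as its new vertex, its parent has already received \<open>a\<close>, and \<open>b\<close> is new.\<close>

definition F' :: "'a \<Rightarrow> 'b set" where
  "F' s = (if s \<in> desc r \<or> y r \<in> F s then insert b (F s) else insert (y r) (F s))"

definition x' :: "'a \<Rightarrow> 'b" where
  "x' s = (if x s = y r then b else x s)"

lemma y_in_vertices: "\<exists>v\<in>V. y r \<in> F v"
  using y_in r_V parent_V by blast

lemma b_neq: "b \<noteq> y r"
  using b_new y_in_vertices by blast

text \<open>A common face of facets in and outside the branch lies in a facet that contains the split vertex.
  This makes the map of Stanley-Reisner rings correct and keeps the edges of the hypertree connected.\<close>

lemma face_of_both_sides:
  assumes "s \<in> desc r" "t \<in> V" "t \<notin> desc r" "S \<subseteq> F s" "S \<subseteq> F t"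
  shows "\<exists>z\<in>V. y r \<in> F z \<and> S \<subseteq> F z"
  using assms
proof (induction "pos s + pos t" arbitrary: s t rule: less_induct)
  case less
  have s: "s \<in> V" using desc_V r_V less by blast
  have "s \<noteq> t" using less by blast
  then consider "pos s < pos t" | "pos t < pos s" using pos_cases s less by blast
  then show ?case
  proof cases
    case 1
    then have tr: "t \<noteq> root" using not_root s less by blast
    have "t \<noteq> r" using less desc_self by blast
    then have "q t \<notin> desc r" using desc_parent tr less by blast
    moreover have "S \<subseteq> F (q t)" using shared_face_in_parent(2) 1 s less by blast
    ultimately show ?thesis
      using less.hyps[of s "q t"] parent_V parent_less tr less.prems by auto
  next
    case 2
    then have sr: "s \<noteq> root" using not_root s less by blast
    have S: "S \<subseteq> F (q s)" using shared_face_in_parent(2) 2 s less by blast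
    show ?thesis
    proof (cases "s = r")
      case True
      then show ?thesis using S y_in r_V parent_V by blast
    next
      case False
      then have "q s \<in> desc r" using desc_parent sr s less by blast
      then show ?thesis
        using less.hyps[of "q s" t] S parent_less s sr less.prems by auto
    qed
  qed
qed

lemma F_sub: "F s \<subseteq> F' s"
  by (auto simp: F'_def)

lemma F'_sub: "F' s \<subseteq> insert (y r) (insert b (F s))"
  by (auto simp: F'_def)

lemma in_F': "c \<noteq> y r \<Longrightarrow> c \<noteq> b \<Longrightarrow> c \<in> F' s \<longleftrightarrow> c \<in> F s"
  by (auto simp: F'_def)

lemma b_in_F': "s \<in> V \<Longrightarrow> b \<in> F' s \<longleftrightarrow> s \<in> desc r \<or> y r \<in> F s"
  using b_new b_neq by (auto simp: F'_def)

lemma y_in_F': "s \<in> V \<Longrightarrow> y r \<in> F' s \<longleftrightarrow> s \<notin> desc r"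
  using y_notin_desc[OF r_V] b_neq by (auto simp: F'_def)

lemma stacking': "stacking V F' pos root q x' (Suc n)"
proof
  fix v assume v: "v \<in> V"
  show "finite (F' v)" using finite_F[OF v] by (simp add: F'_def)
  show "card (F' v) = Suc n"
    using finite_F[OF v] card_F[OF v] b_new[OF v] by (auto simp: F'_def)
  assume nr: "v \<noteq> root"
  note qv = parent_V[OF v nr] parent_less[OF v nr]
  show "x' v \<in> F' v"
    using apex_in[OF v nr] by (auto simp: x'_def F'_def)
  have xb: "x v \<noteq> b" using apex_in[OF v nr] b_new[OF v] by blast
  show "F' v - {x' v} \<subseteq> F' (q v)"
  proof
    fix c assume c: "c \<in> F' v - {x' v}"
    show "c \<in> F' (q v)"
    proof (cases "c = b")
      case True
      then have "x v \<noteq> y r" using c by (auto simp: x'_def)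
      have "v \<in> desc r \<or> y r \<in> F v" using c True b_in_F' v by blast
      then show ?thesis
      proof
        assume v': "v \<in> desc r"
        show ?thesis
        proof (cases "v = r")
          case True
          then show ?thesis using b_in_F' y_in v nr qv \<open>c = b\<close> by auto
        next
          case False
          then show ?thesis using desc_parent[OF v nr False] v' \<open>c = b\<close> b_in_F' qv by blast
        qed
      next
        assume "y r \<in> F v"
        then have "y r \<in> F v - {x v}" using \<open>x v \<noteq> y r\<close> by simp
        then have "y r \<in> F (q v)" using ridge_sub[OF v nr] by (rule subsetD[rotated])
        then show ?thesis using True b_in_F' qv by blast
      qed
    next
      case cb: False
      show ?thesis
      proof (cases "c = y r")
        case True
        then have vd: "v \<notin> desc r" using c y_in_F' v by blast
        then have "v \<noteq> r" using desc_self by blast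
        then have "q v \<notin> desc r" using desc_parent[OF v nr] vd by blast
        then show ?thesis using y_in_F' qv True by blast
      next
        case False
        then have "c \<in> F v" "c \<noteq> x v" using c cb in_F' by (auto simp: x'_def split: if_splits)
        then have "c \<in> F v - {x v}" by simp
        then have "c \<in> F (q v)" using ridge_sub[OF v nr] by (rule subsetD[rotated])
        then show ?thesis using F_sub by (rule subsetD[rotated])
      qed
    qed
  qed
  fix t assume t: "t \<in> V" "pos t < pos v"
  have xt: "x v \<notin> F t" using apex_new[OF v nr t] .
  show "x' v \<notin> F' t"
  proof (cases "x v = y r")
    case False
    then show ?thesis using xt xb in_F' by (simp add: x'_def)
  next
    case True
    have "\<not> pos (q r) < pos v"
      using apex_new[OF v nr, of "q r"] True y_in[OF r_V] parent_V[OF r_V] by auto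
    then have "pos t < pos r" using t parent_less[OF r_V] by simp
    then have "t \<notin> desc r" using desc_pos[of t r] by auto
    then show ?thesis using True xt b_in_F' t by (simp add: x'_def)
  qed
qed (use finite_V inj_pos root_V parent_V parent_less in auto)

sublocale S': stacking V F' pos root q x' "Suc n"
  by (rule stacking')

lemma y_vertex: "y r \<in> vertices complex"
  using y_in_vertices by (auto simp: vertices_complex)

lemma vertices_S': "vertices S'.complex = insert b (vertices complex)"
proof -
  have "b \<in> F' r" using b_in_F' desc_self r_V by blast
  then show ?thesis
    using F_sub F'_sub y_vertex r_V by (fastforce simp: vertices_complex S'.vertices_complex)
qed

lemma b_notin_vertices: "b \<notin> vertices complex"
  using b_new by (auto simp: vertices_complex)

subsection \<open>The splitting is a simple separation\<close>

abbreviation glue :: "'b \<Rightarrow> 'b" where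
  "glue \<equiv> id(b := y r)"

lemma glue_face_imp:
  assumes "glue ` S \<in> complex"
  shows "S \<in> S'.complex"
proof -
  obtain v where v: "v \<in> V" "glue ` S \<subseteq> F v" using assms by (auto simp: in_complex)
  have "c \<in> F' v" if c: "c \<in> S" for c
  proof -
    have "glue c \<in> F v" using v c by blast
    then show ?thesis using F_sub b_in_F'[OF v(1)] by (cases "c = b") auto
  qed
  then show ?thesis using v S'.in_complex by blast
qed

text \<open>The monomial of a non-face is the image of a monomial of a non-face of the split complex, obtained
  by reading the split vertex either as \<open>y r\<close> or as \<open>b\<close>.\<close>

lemma nonface_lift:
  assumes S: "S \<subseteq> vertices complex" "S \<notin> complex"
  shows "S \<notin> S'.complex \<or> (y r \<in> S \<and> (id(y r := b)) ` S \<notin> S'.complex)"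
proof (rule ccontr)
  assume neg: "\<not> ?thesis"
  then obtain v where v: "v \<in> V" "S \<subseteq> F' v" by (auto simp: S'.in_complex)
  have bS: "b \<notin> S" using S b_notin_vertices by blast
  have Sv: "S - {y r} \<subseteq> F v" using v bS in_F' by blast
  have yS: "y r \<in> S"
  proof (rule ccontr)
    assume "y r \<notin> S"
    then have "S \<subseteq> F v" using Sv by simp
    then show False using v(1) S(2) in_complex by blast
  qed
  then obtain w where w: "w \<in> V" "(id(y r := b)) ` S \<subseteq> F' w" using neg by (auto simp: S'.in_complex)
  have bw: "b \<in> F' w" using w yS by (force simp: image_iff)
  have Sw: "S - {y r} \<subseteq> F w"
  proof
    fix c assume c: "c \<in> S - {y r}"
    then have "c \<in> F' w" using w by (force simp: image_iff)
    then show "c \<in> F w" using c bS in_F' by blast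
  qed
  have "S \<subseteq> F t" if "S - {y r} \<subseteq> F t" "y r \<in> F t" for t using that by blast
  then have "y r \<notin> F v" "y r \<notin> F w"
    using Sv Sw v(1) w(1) S(2) unfolding in_complex by blast+
  then have "w \<in> desc r" "v \<notin> desc r"
    using bw b_in_F'[OF w(1)] y_in_F'[OF v(1)] yS v by auto
  then obtain z where "z \<in> V" "y r \<in> F z" "S - {y r} \<subseteq> F z"
    using face_of_both_sides[OF _ v(1) _ Sw Sv] by blast
  then show False using S(2) \<open>\<And>t. S - {y r} \<subseteq> F t \<Longrightarrow> y r \<in> F t \<Longrightarrow> S \<subseteq> F t\<close> in_complex by blast
qed

lemma push_nonfaces: "push glue ` nonface_expos S'.complex = nonface_expos complex"
proof (intro equalityI subsetI)
  fix m assume "m \<in> push glue ` nonface_expos S'.complex"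
  then obtain m' where m': "m = push glue m'" "Poly_Mapping.keys m' \<subseteq> vertices S'.complex"
    "Poly_Mapping.keys m' \<notin> S'.complex" by (auto simp: nonface_expos_def)
  then show "m \<in> nonface_expos complex"
    using glue_face_imp[of "Poly_Mapping.keys m'"] y_vertex
    by (auto simp: nonface_expos_def vertices_S')
next
  fix m assume m: "m \<in> nonface_expos complex"
  let ?S = "Poly_Mapping.keys m"
  have S: "?S \<subseteq> vertices complex" "?S \<notin> complex" using m by (auto simp: nonface_expos_def)
  have bS: "b \<notin> ?S" using S b_notin_vertices by blast
  from nonface_lift[OF S] show "m \<in> push glue ` nonface_expos S'.complex"
  proof
    assume "?S \<notin> S'.complex"
    then have "m \<in> nonface_expos S'.complex" using S by (auto simp: nonface_expos_def vertices_S')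
    moreover have "push glue m = m" using bS by (intro push_fixed) auto
    ultimately show ?thesis by force
  next
    let ?p = "id(y r := b)"
    assume nf: "y r \<in> ?S \<and> ?p ` ?S \<notin> S'.complex"
    have inj: "inj_on ?p ?S" using bS by (auto simp: inj_on_def)
    have "push glue (push ?p m) = push (glue \<circ> ?p) m" using inj by (rule push_push)
    also have "\<dots> = m" using bS by (intro push_fixed) auto
    finally have "push glue (push ?p m) = m" .
    moreover have "push ?p m \<in> nonface_expos S'.complex"
      using nf S by (auto simp: nonface_expos_def vertices_S')
    ultimately show ?thesis by force
  qed
qed

lemma simple_separation_split:
  "simple_separation (vertices complex) (stanley_reisner complex :: ('b, 'k::field) mpoly set)
     glue b (y r) (vertices S'.complex) (stanley_reisner S'.complex)"
  unfolding simple_separation_def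
proof (intro conjI)
  note X = simplicial_complex and X' = S'.simplicial_complex
  show "finite (vertices complex)" "finite (vertices S'.complex)"
    using finite_vertices X X' by blast+
  then show "card (vertices S'.complex) = card (vertices complex) + 1"
    using b_notin_vertices by (simp add: vertices_S')
  show "glue ` vertices S'.complex = vertices complex"
    using y_vertex b_notin_vertices by (auto simp: vertices_S' image_iff)
  show bv: "b \<in> vertices S'.complex" and yv: "y r \<in> vertices S'.complex" and "b \<noteq> y r" and "glue b = glue (y r)"
    using y_vertex b_neq by (auto simp: vertices_S')
  show "monomial_ideal (vertices complex) (stanley_reisner complex :: ('b, 'k) mpoly set)"
    "monomial_ideal (vertices S'.complex) (stanley_reisner S'.complex :: ('b, 'k) mpoly set)"
    unfolding monomial_ideal_iff using stanley_reisner_supported[OF X] stanley_reisner_supported[OF X'] by blast+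
  show "stanley_reisner complex = induced_map glue ` (stanley_reisner S'.complex :: ('b, 'k) mpoly set)"
    by (simp only: stanley_reisner_supported(1)[OF X] stanley_reisner_supported(1)[OF X']
        induced_map_supported push_nonfaces)
  have F'in: "F' v \<in> S'.complex" if "v \<in> V" for v using that S'.in_complex by blast
  have maxl: "insert c (F' v) \<notin> S'.complex" if "v \<in> V" "c \<notin> F' v" for v c
  proof
    assume "insert c (F' v) \<in> S'.complex"
    then obtain w where w: "w \<in> V" "insert c (F' v) \<subseteq> F' w" by (auto simp: S'.in_complex)
    then show False using S'.F_not_subset[OF that(1) w(1)] that(2) by blast
  qed
  show "\<exists>m\<in>min_generators (stanley_reisner S'.complex :: ('b, 'k) mpoly set). b \<in> Poly_Mapping.keys m"
    using F'in[OF u_V(1)] maxl[OF u_V(1)] b_in_F'[OF u_V(1)] u_V bv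
    by (intro min_generator_containing[OF X']) auto
  show "\<exists>m\<in>min_generators (stanley_reisner S'.complex :: ('b, 'k) mpoly set). y r \<in> Poly_Mapping.keys m"
    using F'in[OF r_V(1)] maxl[OF r_V(1)] y_in_F'[OF r_V(1)] desc_self yv
    by (intro min_generator_containing[OF X']) auto
  show "nonzero_divisor (poly_ring (vertices S'.complex) Quot (stanley_reisner S'.complex :: ('b, 'k) mpoly set))
     (stanley_reisner S'.complex +>\<^bsub>poly_ring (vertices S'.complex)\<^esub> (pvar b - pvar (y r)))"
  proof (rule nonzero_divisor_stanley_reisner[OF X' \<open>b \<noteq> y r\<close> bv yv])
    fix S assume "S \<in> S'.complex"
    then obtain v where "v \<in> V" "S \<subseteq> F' v" by (auto simp: S'.in_complex)
    then show "insert b S \<in> S'.complex \<or> insert (y r) S \<in> S'.complex"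
      using b_in_F' y_in_F' S'.in_complex by (metis insert_subset)
  qed
qed

lemma facet_map_split:
  assumes v: "v \<in> V"
  shows "facet_map glue b (y r) (F' v) = F v"
proof -
  have 1: "glue ` (F' v - {b, y r}) = F v - {y r}"
    using b_new[OF v] by (force simp: F'_def)
  show ?thesis
    unfolding facet_map_def 1 using b_in_F'[OF v] y_in_F'[OF v] y_notin_desc[OF r_V, of v] by auto
qed

subsection \<open>The splitting refines the hypertree\<close>

lemma edge_S'_in_edge:
  assumes "e' \<in> S'.edges"
  shows "\<exists>e\<in>edges. e' \<subseteq> e"
proof -
  obtain G where G: "e' = S'.star G" "finite G" "card G + 1 = Suc n" "card (S'.star G) \<ge> 2"
    using assms by (auto simp: S'.edges_def)
  obtain s t where st: "s \<in> e'" "t \<in> e'" "s \<noteq> t" using S'.edge_two assms by blast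
  have mem: "v \<in> V" "G \<subseteq> F' v" if "v \<in> e'" for v using that G by (auto simp: S'.star_def)
  have "\<exists>c\<in>G. \<forall>v\<in>e'. G - {c} \<subseteq> F v"
  proof (cases "b \<in> G")
    case True
    have "G - {b} \<subseteq> F v" if "v \<in> e'" for v
    proof -
      have "v \<in> desc r \<or> y r \<in> F v" using mem[OF that] True b_in_F' by blast
      then have "F' v = insert b (F v)" by (auto simp: F'_def)
      then show ?thesis using mem[OF that] by blast
    qed
    then show ?thesis using True by blast
  next
    case False
    have "y r \<in> G"
    proof (rule ccontr)
      assume "y r \<notin> G"
      then have "G \<subseteq> F s" using mem[OF st(1)] False F'_sub by blast
      then have "G = F s" "G \<subseteq> F t"
        using mem[OF st(1)] mem[OF st(2)] finite_F card_F G False \<open>y r \<notin> G\<close> F'_sub card_subset_eq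
        by (metis add_right_cancel Suc_eq_plus1, blast)
      then show False using F_not_subset st mem by blast
    qed
    moreover have "G - {y r} \<subseteq> F v" if "v \<in> e'" for v
      using mem[OF that] False F'_sub by blast
    ultimately show ?thesis by blast
  qed
  then obtain c where c: "c \<in> G" "\<And>v. v \<in> e' \<Longrightarrow> G - {c} \<subseteq> F v" by blast
  have sub: "e' \<subseteq> star (G - {c})" using c(2) mem by (auto simp: star_def)
  have "finite (star (G - {c}))" using finite_V by (simp add: star_def)
  then have "card e' \<le> card (star (G - {c}))" using sub by (intro card_mono)
  moreover have "n > 0" using G(2,3) c(1) card_gt_0_iff[of G] by auto
  ultimately have "star (G - {c}) \<in> edges"
    using G c(1) by (auto simp: edges_def)
  then show ?thesis using sub by blast
qed

lemma edge_covered: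
  assumes e: "e \<in> edges" and v: "v \<in> e"
  shows "\<exists>e'\<in>S'.edges. e' \<subseteq> e \<and> v \<in> e'"
proof -
  obtain G where G: "e = star G" "finite G" "card G + 1 = n" "card (star G) \<ge> 2"
    using e by (auto simp: edges_def)
  have V: "w \<in> V" "G \<subseteq> F w" if "w \<in> e" for w using that G by (auto simp: star_def)
  have bG: "b \<notin> G" using V[OF v] b_new by blast
  obtain w0 where w0: "w0 \<in> e" "w0 \<noteq> v" using edge_two[OF e] by metis
  \<comment> \<open>It suffices to enlarge the ridge by one of the two vertices.\<close>
  have enlarge: ?thesis
    if c: "c = b \<or> c = y r" "c \<notin> G" and w: "w \<in> e" "w \<noteq> v" "c \<in> F' v" "c \<in> F' w"
      and yG: "y r \<notin> G \<or> c = b" for c w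
  proof (intro bexI[of _ "S'.star (insert c G)"] conjI)
    have mem: "v \<in> S'.star (insert c G)" "w \<in> S'.star (insert c G)"
      using V[OF v] V[OF w(1)] w F_sub by (auto simp: S'.star_def)
    then show "v \<in> S'.star (insert c G)" by blast
    have "finite (S'.star (insert c G))" using finite_V by (simp add: S'.star_def)
    then have "card {v, w} \<le> card (S'.star (insert c G))" using mem by (intro card_mono) auto
    then show "S'.star (insert c G) \<in> S'.edges"
      using w(2) G(2,3) c(2) unfolding S'.edges_def
      by (intro CollectI exI[of _ "insert c G"]) auto
    show "S'.star (insert c G) \<subseteq> e"
    proof
      fix z assume "z \<in> S'.star (insert c G)"
      then have z: "z \<in> V" "c \<in> F' z" "G \<subseteq> F' z" by (auto simp: S'.star_def)
      have "G \<subseteq> F z"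
      proof
        fix g assume g: "g \<in> G"
        show "g \<in> F z"
        proof (cases "g = y r")
          case False
          then show ?thesis using g z bG in_F' by blast
        next
          case True
          then have "b \<in> F' z" "y r \<in> F' z" using yG z g by auto
          then show ?thesis using True b_in_F'[OF z(1)] y_in_F'[OF z(1)] by blast
        qed
      qed
      then show "z \<in> e" using z G by (auto simp: star_def)
    qed
  qed
  show ?thesis
  proof (cases "y r \<in> G")
    case True
    then have "b \<in> F' v" "b \<in> F' w0" using V[OF v] V[OF w0(1)] b_in_F' by auto
    then show ?thesis using enlarge[of b w0] bG w0 by blast
  next
    case yG: False
    show ?thesis
    proof (cases "(\<exists>w\<in>e. w \<noteq> v \<and> b \<in> F' w \<and> b \<in> F' v) \<or> (\<exists>w\<in>e. w \<noteq> v \<and> y r \<in> F' w \<and> y r \<in> F' v)")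
      case True
      then show ?thesis using enlarge[of b] enlarge[of "y r"] bG yG by blast
    next
      case split: False
      \<comment> \<open>No other member of \<open>e\<close> receives the same new vertex as \<open>v\<close>. Then \<open>v\<close> and \<open>w0\<close> lie on different
        sides, and \<open>e\<close> must contain a facet through \<open>y r\<close>, which receives both.\<close>
      have none: "\<not> (y r \<in> F z)" if z: "z \<in> e" for z
      proof
        assume "y r \<in> F z"
        then have bz: "b \<in> F' z" "y r \<in> F' z" using b_in_F' V[OF z] F_sub by blast+
        have two: "b \<in> F' w \<or> y r \<in> F' w" if "w \<in> e" for w
          using b_in_F' y_in_F' V[OF that] by blast
        show False
        proof (cases "z = v")
          case True
          then show ?thesis using two[OF w0(1)] bz w0 split by blast
        next
          case False
          then show ?thesis using two[OF v] bz z split by blast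
        qed
      qed
      have "v \<in> desc r \<longleftrightarrow> w0 \<notin> desc r"
        using split w0 b_in_F' y_in_F' V[OF v] V[OF w0(1)] by blast
      then have "\<exists>z\<in>V. y r \<in> F z \<and> G \<subseteq> F z"
        using face_of_both_sides[of v w0 G] face_of_both_sides[of w0 v G] V[OF v] V[OF w0(1)] by blast
      then show ?thesis using none G(1) by (auto simp: star_def)
    qed
  qed
qed

lemma refinement_split: "refinement (V, S'.edges) (V, edges)"
  unfolding refinement_def fst_conv snd_conv
proof (intro conjI ballI)
  show "hypertree (V, S'.edges)" "hypertree (V, edges)"
    using S'.hypertree_edges hypertree_edges by blast+
  fix e assume e: "e \<in> edges"
  show "\<exists>S\<subseteq>S'.edges. e = \<Union>S"
    using edge_covered[OF e] by (intro exI[of _ "{e' \<in> S'.edges. e' \<subseteq> e}"]) blast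
qed (use edge_S'_in_edge in auto)

end

lemma (in stacking) separates:
  assumes "card V \<ge> n + 2" "b \<notin> vertices complex"
  shows "\<exists>X' \<phi> F'. separates_to TYPE('k::field) complex \<phi> X' \<and> stacked X' \<and>
     facet_indexing X' V F' \<and> (\<forall>v\<in>V. \<phi> (F' v) = F v) \<and>
     refinement (assoc_hypertree X' V F') (V, edges)"
proof -
  obtain r u where ru: "r \<in> V - {root}" "u \<in> V - desc r" "y r \<notin> F u"
    using exists_splitting[OF assms(1)] by blast
  interpret splitting V F pos root q x n r u b
    by unfold_locales (use ru assms(2) in \<open>auto simp: vertices_complex\<close>)
  show ?thesis
  proof (intro exI conjI)
    show "separates_to TYPE('k) complex (facet_map glue b (y r)) S'.complex"
      unfolding separates_to_def by (rule separation.single, rule simple_separation_split)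
    show "stacked S'.complex" by (rule S'.stacked_complex)
    show "facet_indexing S'.complex V F'" by (rule S'.facet_indexing)
    show "\<forall>v\<in>V. facet_map glue b (y r) (F' v) = F v" using facet_map_split by blast
    show "refinement (assoc_hypertree S'.complex V F') (V, edges)"
      unfolding S'.assoc_hypertree_complex by (rule refinement_split)
  qed
qed

section \<open>Simple separations of Stanley-Reisner ideals\<close>

lemma lookup_le_push: "Poly_Mapping.lookup m c \<le> Poly_Mapping.lookup (push p m) (p c)"
proof (cases "c \<in> Poly_Mapping.keys m")
  case True
  then show ?thesis
    unfolding lookup_push by (intro member_le_sum) auto
qed (simp add: in_keys_iff)

lemma push_squarefree_inj:
  assumes "\<And>b. Poly_Mapping.lookup (push p m) b \<le> 1"
  shows "inj_on p (Poly_Mapping.keys m)"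
proof (rule inj_onI, rule ccontr)
  fix c c' assume c: "c \<in> Poly_Mapping.keys m" "c' \<in> Poly_Mapping.keys m" "p c = p c'" "c \<noteq> c'"
  have "(\<Sum>a\<in>{c, c'}. Poly_Mapping.lookup m a) \<le> Poly_Mapping.lookup (push p m) (p c)"
    unfolding lookup_push using c by (intro sum_mono2) auto
  moreover have "Poly_Mapping.lookup m c > 0" "Poly_Mapping.lookup m c' > 0"
    using c by (auto simp: in_keys_iff)
  ultimately show False using assms[of "p c"] c(4) by simp
qed

text \<open>What a simple separation of the Stanley-Reisner ideal of \<open>X\<close> to an arbitrary monomial ideal
  implies on the level of monomials; \<open>M\<close> is the set of monomials of the separated ideal.\<close>

locale monomial_separation =
  fixes X :: "'v set set" and A' :: "'w set" and M :: "'w expo set" and p :: "'w \<Rightarrow> 'v" and a1 a2 :: 'w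
  assumes X: "simplicial_complex X"
    and finite_A': "finite A'"
    and up: "upclosed A' M"
    and push_M: "push p ` M = nonface_expos X"
    and a12: "a1 \<in> A'" "a2 \<in> A'" "a1 \<noteq> a2" "p a1 = p a2"
    and surj: "p ` A' = vertices X"
    and inj: "c \<in> A' \<Longrightarrow> c' \<in> A' \<Longrightarrow> p c = p c' \<Longrightarrow> c = c' \<or> c \<in> {a1, a2} \<and> c' \<in> {a1, a2}"
    and cancel: "m \<in> expos A' \<Longrightarrow> Poly_Mapping.single a1 1 + m \<in> M \<Longrightarrow> Poly_Mapping.single a2 1 + m \<in> M \<Longrightarrow> m \<in> M"
    and gen1: "\<exists>m\<in>M. a1 \<in> Poly_Mapping.keys m \<and>
        (\<forall>m'\<in>M. (\<forall>c. Poly_Mapping.lookup m' c \<le> Poly_Mapping.lookup m c) \<longrightarrow> m' = m)"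
    and gen2: "\<exists>m\<in>M. a2 \<in> Poly_Mapping.keys m \<and>
        (\<forall>m'\<in>M. (\<forall>c. Poly_Mapping.lookup m' c \<le> Poly_Mapping.lookup m c) \<longrightarrow> m' = m)"
begin

text \<open>The variables over \<open>S\<close>, for a set \<open>S\<close> that does not contain the common image of \<open>a1\<close> and \<open>a2\<close>.\<close>

definition lift :: "'v set \<Rightarrow> 'w set" where
  "lift S = {c \<in> A' - {a1, a2}. p c \<in> S}"

text \<open>\<open>side c S\<close>, for \<open>c\<close> one of \<open>a1\<close> and \<open>a2\<close>: the monomial of \<open>S\<close> is moved into the ideal by the
  variable of \<open>c\<close>.\<close>

definition side :: "'w \<Rightarrow> 'v set \<Rightarrow> bool" where
  "side c S \<longleftrightarrow> squarefree_expo (insert c (lift S)) \<in> M"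

lemma swap: "monomial_separation X A' M p a2 a1"
  by unfold_locales (use X finite_A' up push_M a12 surj inj cancel gen1 gen2 in auto)

lemma finite_lift [simp]: "finite (lift S)"
  using finite_A' by (simp add: lift_def)

lemma in_M: "m \<in> M \<Longrightarrow> Poly_Mapping.keys m \<subseteq> A'" "m \<in> M \<Longrightarrow> p ` Poly_Mapping.keys m \<notin> X"
  using up push_M by (auto simp: upclosed_def expos_def nonface_expos_def set_eq_iff image_iff) (metis keys_push)

lemma ex_lift_nonface:
  assumes "S \<subseteq> vertices X" "S \<notin> X"
  shows "\<exists>m\<in>M. p ` Poly_Mapping.keys m = S \<and> inj_on p (Poly_Mapping.keys m) \<and>
    (\<forall>c. Poly_Mapping.lookup m c \<le> 1)"
proof -
  have fS: "finite S" using assms finite_vertices[OF X] finite_subset by blast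
  then have "squarefree_expo S \<in> nonface_expos X" using assms by (simp add: nonface_expos_def)
  then obtain m where m: "m \<in> M" "push p m = squarefree_expo S" unfolding push_M[symmetric] by force
  have le: "Poly_Mapping.lookup (push p m) b \<le> 1" for b
    using fS by (simp add: m(2) lookup_squarefree_expo)
  show ?thesis
  proof (intro bexI[OF _ m(1)] conjI allI)
    show "p ` Poly_Mapping.keys m = S" using fS keys_push[of p m] by (simp add: m(2))
    show "inj_on p (Poly_Mapping.keys m)" using le by (rule push_squarefree_inj)
    show "Poly_Mapping.lookup m c \<le> 1" for c
      using lookup_le_push[of m c p] le[of "p c"] by (rule order_trans)
  qed
qed

lemma side_mono:
  assumes "c \<in> {a1, a2}" "side c S" "S \<subseteq> S'"
  shows "side c S'"
  unfolding side_def
proof (rule upclosed_le[OF up assms(2)[unfolded side_def]])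
  have "insert c (lift S') \<subseteq> A'" using assms(1) a12 by (auto simp: lift_def)
  then show "squarefree_expo (insert c (lift S')) \<in> expos A'" by (simp add: expos_def)
  show "\<forall>b. Poly_Mapping.lookup (squarefree_expo (insert c (lift S))) b
      \<le> Poly_Mapping.lookup (squarefree_expo (insert c (lift S'))) b"
  proof (intro allI squarefree_expo_le)
    have "insert c (lift S) \<subseteq> insert c (lift S')" using assms(3) by (auto simp: lift_def)
    then show "insert c (lift S) \<subseteq> Poly_Mapping.keys (squarefree_expo (insert c (lift S')))" by simp
  qed simp
qed

lemma image_lift:
  assumes "S \<subseteq> vertices X" "p a1 \<notin> S"
  shows "p ` lift S = S"
proof (intro equalityI subsetI)
  fix b assume b: "b \<in> S"
  then obtain c where c: "c \<in> A'" "b = p c" using assms(1) surj by blast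
  then have "c \<in> lift S" using b assms(2) a12(4) by (auto simp: lift_def)
  then show "b \<in> p ` lift S" using c by blast
qed (auto simp: lift_def)

text \<open>By the following two lemmas every face that becomes a non-face on adding the split vertex has
  exactly one side.\<close>

lemma side_exclusive:
  assumes "S \<in> X" "p a1 \<notin> S"
  shows "\<not> (side a1 S \<and> side a2 S)"
proof
  assume s: "side a1 S \<and> side a2 S"
  have split: "squarefree_expo (insert c (lift S)) = Poly_Mapping.single c 1 + squarefree_expo (lift S)"
    if "c \<in> {a1, a2}" for c
    using that unfolding squarefree_expo_def by (subst sum.insert) (auto simp: lift_def finite_A')
  have "squarefree_expo (lift S) \<in> expos A'" by (auto simp: expos_def) (auto simp: lift_def)
  moreover have "Poly_Mapping.single a1 1 + squarefree_expo (lift S) \<in> M"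
    using s split[of a1] unfolding side_def by auto
  moreover have "Poly_Mapping.single a2 1 + squarefree_expo (lift S) \<in> M"
    using s split[of a2] unfolding side_def by auto
  ultimately have "squarefree_expo (lift S) \<in> M" by (rule cancel)
  then have "p ` lift S \<notin> X" using in_M(2) by fastforce
  moreover have "S \<subseteq> vertices X" using assms by (auto simp: vertices_def)
  ultimately show False using image_lift assms by simp
qed

lemma side_cover:
  assumes S: "S \<in> X" "p a1 \<notin> S" "insert (p a1) S \<notin> X"
  shows "side a1 S \<or> side a2 S"
proof -
  have "insert (p a1) S \<subseteq> vertices X" using S surj a12 by (auto simp: vertices_def)
  then obtain m where m: "m \<in> M" "p ` Poly_Mapping.keys m = insert (p a1) S"
    "inj_on p (Poly_Mapping.keys m)" "\<And>c. Poly_Mapping.lookup m c \<le> 1"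
    using ex_lift_nonface[OF _ S(3)] by metis
  have "p a1 \<in> p ` Poly_Mapping.keys m" using m(2) by simp
  then obtain c where c: "c \<in> Poly_Mapping.keys m" "p c = p a1" unfolding image_iff by metis
  have cA: "c \<in> {a1, a2}" using inj[of c a1] in_M(1)[OF m(1)] c a12 by auto
  have sub: "Poly_Mapping.keys m \<subseteq> insert c (lift S)"
  proof
    fix b assume b: "b \<in> Poly_Mapping.keys m"
    show "b \<in> insert c (lift S)"
    proof (cases "b = c")
      case False
      then have "p b \<noteq> p a1" using inj_onD[OF m(3), of b c] b c by auto
      then have "p b \<in> S" "b \<notin> {a1, a2}" using m(2) b a12(4) by auto
      then show ?thesis using in_M(1)[OF m(1)] b by (auto simp: lift_def)
    qed simp
  qed
  have "squarefree_expo (insert c (lift S)) \<in> M"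
  proof (rule upclosed_le[OF up m(1)])
    have "insert c (lift S) \<subseteq> A'" using cA a12 by (auto simp: lift_def)
    then show "squarefree_expo (insert c (lift S)) \<in> expos A'" by (simp add: expos_def)
    show "\<forall>b. Poly_Mapping.lookup m b \<le> Poly_Mapping.lookup (squarefree_expo (insert c (lift S))) b"
      using sub m(4) by (auto simp: lookup_squarefree_expo in_keys_iff)
  qed
  then show ?thesis using cA by (auto simp: side_def)
qed

text \<open>A minimal generator involving \<open>a1\<close> yields a face on the side of \<open>a1\<close>.\<close>

lemma ex_side:
  "\<exists>S\<in>X. p a1 \<notin> S \<and> insert (p a1) S \<notin> X \<and> side a1 S"
proof -
  obtain m where m: "m \<in> M" "a1 \<in> Poly_Mapping.keys m"
    and min: "\<And>m'. m' \<in> M \<Longrightarrow> (\<And>c. Poly_Mapping.lookup m' c \<le> Poly_Mapping.lookup m c) \<Longrightarrow> m' = m"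
    using gen1 by blast
  define K where "K = Poly_Mapping.keys m - {a1, a2}"
  have KA: "Poly_Mapping.keys m \<subseteq> A'" using in_M(1) m by blast
  define S where "S = p ` K"
  have aS: "p a1 \<notin> S"
  proof
    assume "p a1 \<in> S"
    then obtain c where "c \<in> K" "p c = p a1" by (auto simp: S_def)
    then show False using inj[of c a1] KA a12 by (auto simp: K_def)
  qed
  have "insert (p a1) S = p ` Poly_Mapping.keys m"
  proof (intro equalityI subsetI)
    fix b assume "b \<in> insert (p a1) S"
    then show "b \<in> p ` Poly_Mapping.keys m" using m(2) by (auto simp: S_def K_def)
  next
    fix b assume "b \<in> p ` Poly_Mapping.keys m"
    then show "b \<in> insert (p a1) S" using a12(4) by (auto simp: S_def K_def)
  qed
  then have nf: "insert (p a1) S \<notin> X" using in_M(2)[OF m(1)] by simp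
  have SV: "S \<subseteq> vertices X" using KA surj by (auto simp: S_def K_def)
  have S: "S \<in> X"
  proof (rule ccontr)
    assume "S \<notin> X"
    then obtain m' where m': "m' \<in> M" "p ` Poly_Mapping.keys m' = S"
      "\<And>c. Poly_Mapping.lookup m' c \<le> 1"
      using ex_lift_nonface[OF SV] by metis
    have k: "c \<in> K" if "c \<in> Poly_Mapping.keys m'" for c
    proof -
      have "p c \<in> S" using m'(2) that by blast
      then obtain c' where c': "c' \<in> K" "p c = p c'" by (auto simp: S_def)
      then show ?thesis using inj[of c c'] in_M(1)[OF m'(1)] that KA by (auto simp: K_def)
    qed
    have "Poly_Mapping.lookup m' c \<le> Poly_Mapping.lookup m c" for c
    proof (cases "c \<in> Poly_Mapping.keys m'")
      case True
      then have "0 < Poly_Mapping.lookup m c" using k by (auto simp: K_def in_keys_iff)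
      then show ?thesis using m'(3)[of c] by simp
    qed (simp add: in_keys_iff)
    then have "m' = m" using min m'(1) by blast
    then show False using k m(2) by (auto simp: K_def)
  qed
  have lift: "lift S \<subseteq> K"
  proof
    fix c assume c: "c \<in> lift S"
    then obtain c' where "c' \<in> K" "p c = p c'" by (auto simp: S_def lift_def)
    then show "c \<in> K" using inj[of c c'] c KA by (auto simp: lift_def K_def)
  qed
  have "side a1 S"
  proof (rule ccontr)
    assume "\<not> side a1 S"
    then have s2: "squarefree_expo (insert a2 (lift S)) \<in> M"
      using side_cover S aS nf by (auto simp: side_def)
    show False
    proof (cases "a2 \<in> Poly_Mapping.keys m")
      case True
      then have "squarefree_expo (insert a2 (lift S)) = m"
        using lift by (intro min[OF s2] squarefree_expo_le) (auto simp: K_def)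
      then have "Poly_Mapping.keys m = insert a2 (lift S)" by (metis keys_squarefree_expo finite_insert finite_lift)
      then show False using m(2) a12(3) by (auto simp: lift_def)
    next
      case False
      define m0 where "m0 = m - Poly_Mapping.single a1 1"
      have m0: "m = Poly_Mapping.single a1 1 + m0"
        unfolding m0_def using m(2)
        by (intro expo_le_imp_add) (auto simp: lookup_single when_def in_keys_iff Suc_le_eq)
      have "Poly_Mapping.keys m = insert a1 (Poly_Mapping.keys m0)"
        by (subst m0) (simp add: keys_add_expo)
      then have k0: "Poly_Mapping.keys m0 \<subseteq> A'" "K \<subseteq> Poly_Mapping.keys m0" using KA by (auto simp: K_def)
      then have e0: "m0 \<in> expos A'" by (simp add: expos_def)
      have "Poly_Mapping.single a2 1 + m0 \<in> M"
      proof (rule upclosed_le[OF up s2])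
        show "Poly_Mapping.single a2 1 + m0 \<in> expos A'"
          using k0 a12 by (auto simp: expos_def keys_add_expo)
        show "\<forall>c. Poly_Mapping.lookup (squarefree_expo (insert a2 (lift S))) c
            \<le> Poly_Mapping.lookup (Poly_Mapping.single a2 1 + m0) c"
          using lift k0 by (intro allI squarefree_expo_le) (auto simp: keys_add_expo)
      qed
      then have "m0 \<in> M" using cancel e0 m(1) m0 by metis
      then have "m0 = m" by (rule min) (simp add: m0_def lookup_minus)
      then have "Poly_Mapping.lookup m a1 = 1 + Poly_Mapping.lookup m a1"
        using arg_cong[OF m0, of "\<lambda>m. Poly_Mapping.lookup m a1"] by (simp add: lookup_add)
      then show False by simp
    qed
  qed
  then show ?thesis using S aS nf by blast
qed

end

lemma simple_separation_monomial:
  fixes J :: "('w, 'k::field) mpoly set"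
  assumes X: "simplicial_complex X"
    and sep: "simple_separation (vertices X) (stanley_reisner X) p a1 a2 A' J"
  shows "\<exists>M. monomial_separation X A' M p a1 a2"
proof -
  from sep have fin: "finite A'" and surj: "p ` A' = vertices X" and card: "card A' = card (vertices X) + 1"
    and a12: "a1 \<in> A'" "a2 \<in> A'" "a1 \<noteq> a2" "p a1 = p a2" and mono: "monomial_ideal A' J"
    and im: "stanley_reisner X = induced_map p ` J"
    and gens: "\<exists>m\<in>min_generators J. a1 \<in> Poly_Mapping.keys m" "\<exists>m\<in>min_generators J. a2 \<in> Poly_Mapping.keys m"
    and nzd: "nonzero_divisor (poly_ring A' Quot J) (J +>\<^bsub>poly_ring A'\<^esub> (pvar a1 - pvar a2))"
    unfolding simple_separation_def by blast+
  obtain M where M: "upclosed A' M" "J = supported M" using mono by (auto simp: monomial_ideal_iff)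
  have "p ` (A' - {a2}) = vertices X"
  proof -
    have "A' = insert a2 (A' - {a2})" "a1 \<in> A' - {a2}" using a12 by auto
    then have "p ` A' = p ` (A' - {a2})" using a12(4) by (metis image_insert insert_absorb image_eqI)
    then show ?thesis using surj by simp
  qed
  then have inj: "inj_on p (A' - {a2})"
    using fin card a12 by (intro eq_card_imp_inj_on) auto
  have "push p ` M = nonface_expos X"
    using im unfolding stanley_reisner_supported(1)[OF X] M(2) induced_map_supported supported_eq_iff by simp
  have "monomial_separation X A' M p a1 a2"
  proof
    fix c c' assume c: "c \<in> A'" "c' \<in> A'" "p c = p c'"
    \<comment> \<open>\<open>p\<close> is injective once \<open>a1\<close> and \<open>a2\<close> are identified.\<close>
    define h where "h b = (if b = a2 then a1 else b)" for b
    have "h c \<in> A' - {a2}" "h c' \<in> A' - {a2}" "p (h c) = p (h c')"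
      using c a12 by (auto simp: h_def)
    then have "h c = h c'" using inj by (auto dest: inj_onD)
    then show "c = c' \<or> c \<in> {a1, a2} \<and> c' \<in> {a1, a2}" by (auto simp: h_def split: if_splits)
  next
    fix m assume "m \<in> expos A'" "Poly_Mapping.single a1 1 + m \<in> M" "Poly_Mapping.single a2 1 + m \<in> M"
    then show "m \<in> M"
      using nonzero_divisor_monomials[OF M(1) a12(1,2) nzd[unfolded M(2)]] by blast
  next
    show "\<exists>m\<in>M. a1 \<in> Poly_Mapping.keys m \<and>
        (\<forall>m'\<in>M. (\<forall>c. Poly_Mapping.lookup m' c \<le> Poly_Mapping.lookup m c) \<longrightarrow> m' = m)"
      "\<exists>m\<in>M. a2 \<in> Poly_Mapping.keys m \<and>
        (\<forall>m'\<in>M. (\<forall>c. Poly_Mapping.lookup m' c \<le> Poly_Mapping.lookup m c) \<longrightarrow> m' = m)"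
      using gens unfolding M(2) min_generators_supported by blast+
  qed fact+
  then show ?thesis by blast
qed

section \<open>The extremal case\<close>

text \<open>A stacking with the least possible number of facets whose hypertree is an ordinary tree. Every
  attachment drops a different vertex of the first facet, and the sets of facets containing a given
  vertex are the branches of the tree and their complements.\<close>

locale tight_stacking = stacking +
  assumes card_V: "card V = n + 1"
    and not_cone: "\<not> is_cone complex"
    and ordinary: "e \<in> edges \<Longrightarrow> card e = 2"
begin

lemma y_bij: "bij_betw y (V - {root}) (F root)"
proof -
  have sub: "F root \<subseteq> y ` (V - {root})"
    using not_coneD[OF not_cone] first_omission by blast
  have c: "card (V - {root}) = n" using card_V root_V finite_V by simp
  have "card (y ` (V - {root})) \<le> card (F root)"
    using card_image_le[of "V - {root}" y] finite_V c card_F[OF root_V] by simp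
  then have eq: "F root = y ` (V - {root})"
    using sub finite_V by (intro card_seteq) auto
  moreover have "inj_on y (V - {root})"
    using c card_F[OF root_V] finite_V by (intro eq_card_imp_inj_on) (auto simp: eq[symmetric])
  ultimately show ?thesis by (simp add: bij_betw_def)
qed

text \<open>The set of facets through a vertex.\<close>

definition holders :: "'b \<Rightarrow> 'a set" where
  "holders a = {v \<in> V. a \<in> F v}"

lemma holders_y:
  assumes r: "r \<in> V" "r \<noteq> root"
  shows "holders (y r) = V - desc r"
proof -
  have "y r \<in> F v" if "v \<in> V" "v \<notin> desc r" for v
    using that
  proof (induction v rule: parent_induct)
    case root
    then show ?case using y_bij r by (auto simp: bij_betw_def)
  next
    case (step v)
    have "v \<noteq> r" using step.prems desc_self by blast
    then have "q v \<notin> desc r" using desc_parent step by blast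
    then have "y r \<in> F (q v)" using step.IH by blast
    moreover have "y r \<noteq> y v"
      using y_bij r step.hyps \<open>v \<noteq> r\<close> by (auto simp: bij_betw_def dest: inj_onD)
    ultimately show ?case using y_props(1)[OF step.hyps] by auto
  qed
  then show ?thesis using y_notin_desc[OF r] by (auto simp: holders_def)
qed

lemma apex_notin_root: "s \<in> V \<Longrightarrow> s \<noteq> root \<Longrightarrow> x s \<notin> F root"
  using apex_new root_less root_V by blast

lemma x_inj: "s \<in> V \<Longrightarrow> s \<noteq> root \<Longrightarrow> t \<in> V \<Longrightarrow> t \<noteq> root \<Longrightarrow> x s = x t \<Longrightarrow> s = t"
  using pos_cases[of s t] apex_new[of s t] apex_new[of t s] apex_in[of s] apex_in[of t] by auto

lemma holders_x:
  assumes s: "s \<in> V" "s \<noteq> root"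
  shows "holders (x s) = desc s"
proof (intro equalityI subsetI)
  fix v assume "v \<in> holders (x s)"
  then have "v \<in> V" "x s \<in> F v" by (auto simp: holders_def)
  then show "v \<in> desc s"
  proof (induction v rule: parent_induct)
    case root
    then show ?case using apex_notin_root[OF s] by blast
  next
    case (step v)
    show ?case
    proof (cases "v = s")
      case True
      then show ?thesis using desc_self by simp
    next
      case False
      then have "x s \<noteq> x v" using x_inj[OF s step.hyps] by auto
      then have "x s \<in> F (q v)" using y_props(1)[OF step.hyps] step.prems by auto
      then show ?thesis using step desc_step by blast
    qed
  qed
next
  fix v assume "v \<in> desc s"
  then have "x s \<in> F v"
  proof (induction rule: desc.induct)
    case desc_self
    then show ?case using apex_in s by blast
  next
    case (desc_step v)
    have "y v \<in> F root" using y_bij desc_step by (auto simp: bij_betw_def)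
    then have "y v \<noteq> x s" using apex_notin_root[OF s] by auto
    then show ?case using y_props(1)[OF desc_step(1,2)] desc_step by auto
  qed
  then show "v \<in> holders (x s)" using desc_V s \<open>v \<in> desc s\<close> by (auto simp: holders_def)
qed

lemma vertex_cases:
  assumes "a \<in> vertices complex"
  obtains s where "s \<in> V" "s \<noteq> root" "a = x s" | s where "s \<in> V" "s \<noteq> root" "a = y s"
proof -
  obtain v where "v \<in> V" "a \<in> F v" using assms by (auto simp: vertices_complex)
  then have "a \<in> F root \<or> (\<exists>s\<in>V - {root}. a = x s)"
  proof (induction v rule: parent_induct)
    case (step v)
    then show ?case using ridge_sub[OF step.hyps] by auto
  qed simp
  moreover have "F root = y ` (V - {root})" using y_bij by (simp add: bij_betw_def)
  ultimately show thesis using that by blast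
qed

lemma vertex_x: "s \<in> V \<Longrightarrow> s \<noteq> root \<Longrightarrow> x s \<in> vertices complex"
  using apex_in by (auto simp: vertices_complex)

lemma vertex_y: "s \<in> V \<Longrightarrow> s \<noteq> root \<Longrightarrow> y s \<in> vertices complex"
  using y_in parent_V by (auto simp: vertices_complex)

lemma desc_inj: "desc s = desc t \<Longrightarrow> s \<in> V \<Longrightarrow> t \<in> V \<Longrightarrow> s = t"
  using desc_pos[of s t] desc_pos[of t s] desc_self[of s] desc_self[of t] pos_cases[of s t] by auto

lemma holders_inj: "inj_on holders (vertices complex)"
proof (rule inj_onI)
  fix a c assume ac: "a \<in> vertices complex" "c \<in> vertices complex" "holders a = holders c"
  have sub: "desc s \<subseteq> V" "root \<notin> desc s" if "s \<in> V" "s \<noteq> root" for s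
    using that desc_V root_notin_desc by auto
  have compl: "desc s = desc t" if "V - desc s = V - desc t" "s \<in> V" "s \<noteq> root" "t \<in> V" "t \<noteq> root" for s t
    using that sub by blast
  from ac(1) show "a = c"
  proof (cases rule: vertex_cases)
    case (1 s)
    from ac(2) show ?thesis
    proof (cases rule: vertex_cases)
      case t: (1 t)
      then show ?thesis using ac(3) 1 holders_x desc_inj[of s t] by simp
    next
      case t: (2 t)
      then show ?thesis using ac(3) 1 holders_x[of s] holders_y[of t] sub[of s] sub[of t] root_V by auto
    qed
  next
    case (2 s)
    from ac(2) show ?thesis
    proof (cases rule: vertex_cases)
      case t: (1 t)
      then show ?thesis using ac(3) 2 holders_y[of s] holders_x[of t] sub[of s] sub[of t] root_V by auto
    next
      case t: (2 t)
      then show ?thesis using ac(3) 2 holders_y[of s] holders_y[of t] compl[of s t] desc_inj[of s t] by auto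
    qed
  qed
qed

lemma parent_edge_eq:
  assumes s: "s \<in> V" "s \<noteq> root"
  shows "parent_edge s = {q s, s}"
proof -
  have "finite (parent_edge s)" using finite_V by (simp add: parent_edge_def star_def)
  moreover have "q s \<noteq> s" using parent_less[OF s] by auto
  then have "card {q s, s} = 2" by simp
  ultimately show ?thesis
    using parent_edge[OF s] ordinary by (intro card_seteq[symmetric]) auto
qed

lemma edges_eq: "edges = (\<lambda>s. {q s, s}) ` (V - {root})"
proof (intro equalityI subsetI)
  fix e assume e: "e \<in> edges"
  obtain s t where st: "s \<in> e" "t \<in> e" "s \<noteq> t" using edge_two[OF e] by blast
  then have V: "s \<in> V" "t \<in> V" using edge_sub[OF e] by auto
  have "e = {q t, t} \<and> t \<noteq> root \<and> t \<in> V" if "s \<in> e" "t \<in> e" "pos s < pos t" for s t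
    using edge_parent[OF e that] that edge_sub[OF e] not_root[of s t] parent_edge_eq[of t] by auto
  then show "e \<in> (\<lambda>s. {q s, s}) ` (V - {root})"
    using pos_cases[OF V st(3)] st by blast
qed (use parent_edge parent_edge_eq in auto)

lemma parent_pair_inj:
  assumes "s \<in> V" "s \<noteq> root" "t \<in> V" "t \<noteq> root" "{q s, s} = {q t, t}"
  shows "s = t"
  using assms parent_less[of s] parent_less[of t] by (metis doubleton_eq_iff less_asym)

text \<open>The sets of facets through a vertex depend only on the tree: they are the sets \<open>W\<close> of
  vertices of the tree such that exactly one edge meets \<open>W\<close> without being contained in it.\<close>

lemma holders_image:
  "holders ` vertices complex = {W. W \<subseteq> V \<and> (\<exists>!e. e \<in> edges \<and> e \<inter> W \<noteq> {} \<and> \<not> e \<subseteq> W)}"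
proof (intro equalityI subsetI)
  fix W assume "W \<in> holders ` vertices complex"
  then obtain a where a: "a \<in> vertices complex" "W = holders a" by blast
  obtain s where s: "s \<in> V" "s \<noteq> root" and W: "W = desc s \<or> W = V - desc s"
    using a(1)
  proof (cases rule: vertex_cases)
    case (1 s)
    then show ?thesis using that holders_x a(2) by blast
  next
    case (2 s)
    then show ?thesis using that holders_y a(2) by blast
  qed
  have WV: "W \<subseteq> V" using W desc_V s by blast
  have cross: "{q t, t} \<inter> W \<noteq> {} \<and> \<not> {q t, t} \<subseteq> W \<longleftrightarrow> t = s" if t: "t \<in> V" "t \<noteq> root" for t
  proof -
    have "(t \<in> desc s \<longleftrightarrow> q t \<in> desc s) \<longleftrightarrow> t \<noteq> s"
      using desc_parent[OF t, of s] desc_self[of s] desc_pos[of "q s" s] parent_less[OF s] by auto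
    then show ?thesis using W t parent_V[OF t] by auto
  qed
  have "{q s, s} \<in> edges" using s by (auto simp: edges_eq)
  moreover have "{q s, s} \<inter> W \<noteq> {} \<and> \<not> {q s, s} \<subseteq> W" using cross[OF s] by blast
  moreover have "e = {q s, s}" if "e \<in> edges" "e \<inter> W \<noteq> {}" "\<not> e \<subseteq> W" for e
    using that cross by (auto simp only: edges_eq image_iff Diff_iff singleton_iff)
  ultimately have "\<exists>!e. e \<in> edges \<and> e \<inter> W \<noteq> {} \<and> \<not> e \<subseteq> W" by blast
  then show "W \<in> {W. W \<subseteq> V \<and> (\<exists>!e. e \<in> edges \<and> e \<inter> W \<noteq> {} \<and> \<not> e \<subseteq> W)}"
    using WV by blast
next
  fix W assume "W \<in> {W. W \<subseteq> V \<and> (\<exists>!e. e \<in> edges \<and> e \<inter> W \<noteq> {} \<and> \<not> e \<subseteq> W)}"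
  then have WV: "W \<subseteq> V" and ex1: "\<exists>!e. e \<in> edges \<and> e \<inter> W \<noteq> {} \<and> \<not> e \<subseteq> W" by simp_all
  from ex1_implies_ex[OF ex1] obtain e where e: "e \<in> edges" "e \<inter> W \<noteq> {}" "\<not> e \<subseteq> W" by (elim exE conjE)
  have uniq: "f = e" if "f \<in> edges" "f \<inter> W \<noteq> {}" "\<not> f \<subseteq> W" for f
    using ex1 that e unfolding Ex1_def by (metis (no_types, lifting))
  obtain s where s: "s \<in> V" "s \<noteq> root" "e = {q s, s}" using e(1) by (auto simp: edges_eq)
  have same: "t \<in> W \<longleftrightarrow> q t \<in> W" if t: "t \<in> V" "t \<noteq> root" "t \<noteq> s" for t
  proof (rule ccontr)
    assume "\<not> ?thesis"
    then have "{q t, t} = e" using t by (intro uniq) (auto simp: edges_eq)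
    then show False using parent_pair_inj[OF t(1,2) s(1,2)] s(3) t(3) by blast
  qed
  have inside: "t \<in> W \<longleftrightarrow> s \<in> W" if "t \<in> desc s" for t
    using that
  proof (induction rule: desc.induct)
    case (desc_step t)
    then show ?case using same[of t] by (cases "t = s") auto
  qed simp
  have outside: "t \<in> W \<longleftrightarrow> root \<in> W" if "t \<in> V" "t \<notin> desc s" for t
    using that
  proof (induction t rule: parent_induct)
    case (step t)
    then have ts: "t \<noteq> s" using desc_self by blast
    then have "q t \<notin> desc s" using desc_parent[OF step.hyps] step.prems by blast
    then show ?case using step.IH same[OF step.hyps ts] by blast
  qed simp
  have "q s \<notin> desc s" using desc_pos[of "q s" s] parent_less[OF s(1,2)] by auto
  then have "s \<in> W \<longleftrightarrow> root \<notin> W" using outside[of "q s"] parent_V[OF s(1,2)] e s(3) by auto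
  then have "W = desc s \<or> W = V - desc s"
    using inside outside WV desc_V[OF s(1)] by blast
  then show "W \<in> holders ` vertices complex"
    using holders_x[OF s(1,2)] holders_y[OF s(1,2)] vertex_x[OF s(1,2)] vertex_y[OF s(1,2)] by blast
qed

text \<open>The facets that avoid a given vertex form a connected part of the tree, and adjacent ones lie on
  the same side of a simple separation; but a separation has facets on both sides.\<close>

lemma not_simple_separation:
  fixes J :: "('w, 'k::field) mpoly set"
  shows "\<not> simple_separation (vertices complex) (stanley_reisner complex) p a1 a2 A' J"
proof
  assume sep: "simple_separation (vertices complex) (stanley_reisner complex) p a1 a2 A' J"
  obtain M where "monomial_separation complex A' M p a1 a2"
    using simple_separation_monomial[OF simplicial_complex sep] by (rule exE)
  then interpret ms: monomial_separation complex A' M p a1 a2 .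
  interpret ms2: monomial_separation complex A' M p a2 a1 by (rule ms.swap)
  have side2: "ms2.side = ms.side"
    by (intro ext) (simp add: ms.side_def ms2.side_def ms.lift_def ms2.lift_def insert_commute)
  let ?a = "p a1"
  have pa: "p a2 = ?a" using ms.a12 by simp
  have F_in: "F v \<in> complex" if "v \<in> V" for v using that in_complex by blast
  have excl: "\<not> (ms.side a1 (F v) \<and> ms.side a2 (F v))" if "v \<in> V" "?a \<notin> F v" for v
    using ms.side_exclusive F_in that by blast
  \<comment> \<open>Adjacent facets that do not contain the split vertex lie on the same side.\<close>
  have adj: "ms.side a1 (F s) \<longleftrightarrow> ms.side a1 (F (q s))"
    if s: "s \<in> V" "s \<noteq> root" "?a \<notin> F s" "?a \<notin> F (q s)" for s
  proof -
    let ?G = "F s - {x s}"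
    have qs: "q s \<in> V" using parent_V s by blast
    have sub: "?G \<subseteq> F s" "?G \<subseteq> F (q s)" using ridge_sub s by auto
    have "insert ?a ?G \<notin> complex"
    proof
      assume "insert ?a ?G \<in> complex"
      then obtain v where v: "v \<in> V" "insert ?a ?G \<subseteq> F v" by (auto simp: in_complex)
      then have "v \<in> parent_edge s" by (auto simp: parent_edge_def star_def)
      then show False using v s parent_edge_eq by auto
    qed
    moreover have "?G \<in> complex" using sub(1) s(1) in_complex by blast
    ultimately have "ms.side a1 ?G \<or> ms.side a2 ?G" using ms.side_cover s(3) by blast
    then show ?thesis
      using ms.side_mono[OF _ _ sub(1)] ms.side_mono[OF _ _ sub(2)] excl s qs by blast
  qed
  have "?a \<in> vertices complex" using ms.surj ms.a12 by blast
  then have const: "\<exists>w. \<forall>v\<in>V. ?a \<notin> F v \<longrightarrow> (ms.side a1 (F v) \<longleftrightarrow> ms.side a1 (F w))"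
  proof (cases rule: vertex_cases)
    case (1 s)
    have mem: "?a \<in> F v \<longleftrightarrow> v \<in> desc s" if "v \<in> V" for v
      using holders_x[OF 1(1,2)] that 1(3) by (auto simp: holders_def)
    have "ms.side a1 (F v) \<longleftrightarrow> ms.side a1 (F root)" if "v \<in> V" "v \<notin> desc s" for v
      using that
    proof (induction v rule: parent_induct)
      case (step v)
      have "v \<noteq> s" using step.prems desc_self by blast
      then have "q v \<notin> desc s" using desc_parent step by blast
      then show ?case using step adj mem parent_V by blast
    qed simp
    then show ?thesis using mem by blast
  next
    case (2 s)
    have mem: "?a \<notin> F v \<longleftrightarrow> v \<in> desc s" if "v \<in> V" for v
      using holders_y[OF 2(1,2)] that 2(3) by (auto simp: holders_def)
    have "ms.side a1 (F v) \<longleftrightarrow> ms.side a1 (F s)" if "v \<in> desc s" for v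
      using that
    proof (induction rule: desc.induct)
      case (desc_step v)
      then have "v \<in> desc s" by (blast intro: desc.desc_step)
      then show ?case using desc_step adj mem parent_V by blast
    qed simp
    then show ?thesis using mem by blast
  qed
  have facet: "\<exists>v\<in>V. ?a \<notin> F v \<and> ms.side c (F v)"
    if S: "c \<in> {a1, a2}" "S \<in> complex" "insert ?a S \<notin> complex" "ms.side c S" for c S
  proof -
    obtain v where v: "v \<in> V" "S \<subseteq> F v" using S(2) in_complex by blast
    then have "?a \<notin> F v" using S(3) in_complex by blast
    then show ?thesis using ms.side_mono[OF S(1,4) v(2)] v(1) by blast
  qed
  obtain v where "v \<in> V" "?a \<notin> F v" "ms.side a1 (F v)"
    using ms.ex_side facet[of a1] by blast
  moreover obtain w where "w \<in> V" "?a \<notin> F w" "ms.side a2 (F w)"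
    using ms2.ex_side facet[of a2] unfolding side2 pa by blast
  ultimately show False using const excl by blast
qed

end

lemma tight_stackings_iso:
  assumes "tight_stacking V F pos rt q x n" "tight_stacking V F' pos' rt' q' x' n'"
    and edges: "stacking.edges V F n = stacking.edges V F' n'"
  shows "complex_iso (stacking.complex V F) (stacking.complex V F')"
proof -
  interpret X: tight_stacking V F pos rt q x n by fact
  interpret Y: tight_stacking V F' pos' rt' q' x' n' by fact
  have bX: "bij_betw X.holders (vertices X.complex) (X.holders ` vertices X.complex)"
    using X.holders_inj by (simp add: bij_betw_def)
  have bY: "bij_betw Y.holders (vertices Y.complex) (X.holders ` vertices X.complex)"
    using Y.holders_inj X.holders_image Y.holders_image edges by (simp add: bij_betw_def)
  define f where "f = the_inv_into (vertices Y.complex) Y.holders \<circ> X.holders"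
  have bij: "bij_betw f (vertices X.complex) (vertices Y.complex)"
    unfolding f_def by (rule bij_betw_trans[OF bX bij_betw_the_inv_into[OF bY]])
  have hold: "Y.holders (f a) = X.holders a" if "a \<in> vertices X.complex" for a
  proof -
    have "X.holders a \<in> Y.holders ` vertices Y.complex" using that bY by (simp add: bij_betw_def)
    then show ?thesis using bY unfolding f_def comp_def bij_betw_def by (metis f_the_inv_into_f)
  qed
  have mem: "f a \<in> F' v \<longleftrightarrow> a \<in> F v" if "a \<in> vertices X.complex" "v \<in> V" for a v
    using hold[OF that(1)] that(2) by (auto simp: X.holders_def Y.holders_def set_eq_iff)
  have img: "f ` F v = F' v" if v: "v \<in> V" for v
  proof (intro equalityI subsetI)
    fix c assume "c \<in> f ` F v"
    then show "c \<in> F' v" using mem v by (auto simp: X.vertices_complex)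
  next
    fix c assume c: "c \<in> F' v"
    then have "c \<in> vertices Y.complex" using v by (auto simp: Y.vertices_complex)
    then obtain a where "a \<in> vertices X.complex" "c = f a" using bij by (auto simp: bij_betw_def)
    then show "c \<in> f ` F v" using mem c v by blast
  qed
  have "Y.complex = (\<lambda>S. f ` S) ` X.complex"
  proof (intro equalityI subsetI)
    fix S assume "S \<in> Y.complex"
    then obtain v where v: "v \<in> V" "S \<subseteq> f ` F v" by (auto simp: Y.in_complex img)
    then obtain R where "R \<subseteq> F v" "S = f ` R" by (auto simp: subset_image_iff)
    then show "S \<in> (\<lambda>S. f ` S) ` X.complex" using v X.in_complex by blast
  next
    fix S assume "S \<in> (\<lambda>S. f ` S) ` X.complex"
    then show "S \<in> Y.complex" using img by (auto simp: X.in_complex Y.in_complex) (metis image_mono)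
  qed
  then show ?thesis unfolding complex_iso_def using bij by blast
qed

theorem proposition3p7:
  fixes X :: "'v::infinite set set"
    and d :: int
    and V :: "'i set"
    and F :: "'i \<Rightarrow> 'v set"
    and T :: "'i hypergraph"
  assumes "stacked X"
    and "complex_dim X = d"
    and "\<not> is_cone X"
    and "facet_indexing X V F"
    and "T = assoc_hypertree X V F"
  shows "int (card (hverts T)) \<ge> d + 2 \<and>
    ((\<exists>e\<in>hedges T. card e \<ge> 3) \<longrightarrow> int (card (hverts T)) \<ge> d + 3) \<and>
    (int (card (hverts T)) \<ge> d + 3 \<longrightarrow>
       (\<exists>(X' :: 'v set set) \<phi> F'.
          separates_to TYPE('k::field) X \<phi> X' \<and> stacked X' \<and>
          facet_indexing X' V F' \<and> (\<forall>v\<in>V. \<phi> (F' v) = F v) \<and>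
          refinement (assoc_hypertree X' V F') T)) \<and>
    (ordinary_tree T \<and> int (card (hverts T)) = d + 2 \<longrightarrow>
       inseparable TYPE('k) X \<and>
       (\<forall>(Y :: 'w set set) F'.
          stacked Y \<and> complex_dim Y = d \<and> \<not> is_cone Y \<and>
          facet_indexing Y V F' \<and> assoc_hypertree Y V F' = T \<longrightarrow> complex_iso X Y))"
proof -
  obtain pos root q x n where "stacking V F pos root q x n"
    using stacked_imp_stacking(1)[OF assms(1,4)] by blast
  then interpret stacking V F pos root q x n .
  have X: "X = complex" using stacked_imp_stacking(2)[OF assms(1,4)] .
  have T: "T = (V, edges)" using assms(5) assoc_hypertree_complex by (simp add: X)
  have d: "d = int n - 1" using assms(2) dim_complex by (simp add: X)
  have nc: "\<not> is_cone complex" using assms(3) by (simp add: X)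
  show ?thesis
  proof (intro conjI impI allI)
    show "int (card (hverts T)) \<ge> d + 2"
      using card_V_ge[OF nc] by (simp add: T d)
    show "int (card (hverts T)) \<ge> d + 3" if "\<exists>e\<in>hedges T. card e \<ge> 3"
      using card_V_ge_of_large_edge[OF nc] that by (force simp: T d)
    show "\<exists>(X' :: 'v set set) \<phi> F'.
          separates_to TYPE('k) X \<phi> X' \<and> stacked X' \<and>
          facet_indexing X' V F' \<and> (\<forall>v\<in>V. \<phi> (F' v) = F v) \<and>
          refinement (assoc_hypertree X' V F') T"
      if "int (card (hverts T)) \<ge> d + 3"
    proof -
      obtain b where "b \<notin> vertices complex"
        using ex_new_if_finite[OF infinite_UNIV finite_vertices[OF simplicial_complex]] by blast
      moreover have "card V \<ge> n + 2" using that by (simp add: T d)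
      ultimately show ?thesis using separates unfolding T X by blast
    qed
  next
    assume tight: "ordinary_tree T \<and> int (card (hverts T)) = d + 2"
    have tX: "tight_stacking V F pos root q x n"
      using tight nc by unfold_locales (auto simp: T d ordinary_tree_def)
    then interpret tight_stacking V F pos root q x n .
    show "inseparable TYPE('k) X"
      unfolding inseparable_def X by (intro notI, elim exE) (rule notE[OF not_simple_separation])
    fix Y :: "'w set set" and F'
    assume Y: "stacked Y \<and> complex_dim Y = d \<and> \<not> is_cone Y \<and>
          facet_indexing Y V F' \<and> assoc_hypertree Y V F' = T"
    then obtain pos' root' q' x' n' where "stacking V F' pos' root' q' x' n'"
      using stacked_imp_stacking(1) by blast
    then interpret Y: stacking V F' pos' root' q' x' n' .
    have Y': "Y = Y.complex" using stacked_imp_stacking(2) Y by blast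
    have "n' = n" using Y Y.dim_complex by (simp add: Y' d)
    have edges': "Y.edges = edges" using Y Y.assoc_hypertree_complex by (simp add: Y' T)
    have "tight_stacking V F' pos' root' q' x' n'"
      using Y card_V ordinary edges' \<open>n' = n\<close> by unfold_locales (auto simp: Y')
    from tight_stackings_iso[OF tX this] edges' show "complex_iso X Y"
      by (simp add: X Y')
  qed
qed

end
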